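(* Let $V$ be a two-sided quaternionic Banach space and let $T$ be the quaternionic infinitesimal generator of a strongly continuous group $(\mathcal{Z}_T(t))_{t\in\mathbb{R}}$ of bounded right linear operators on $V$. Let $f=\mathcal{L}(\mu)$ and $g=\mathcal{L}(\nu)$, with $\mu,\nu\in\mathbf{S}(T)$, belong to $\mathbf{V}(T)$ and let $a\in\mathbb{H}$. (i) $(af)(T)=a\,f(T)$ and $(f+g)(T)=f(T)+g(T)$. (ii) If $g$ is an intrinsic function, then $\nu$ is real-valued and $(fg)(T)=f(T)g(T)$, where $fg$ is the pointwise product. (These identities are understood to include that $af$, $f+g$ and, in (ii), $fg$ belong to $\mathbf{V}(T)$.)
   Context: $\mathbb{H}$ denotes the quaternions, with real part $\mathrm{Re}(s)$, conjugate $\overline{s}$ and modulus $|s|$. A two-sided quaternionic Banach space $V$ is a two-sided $\mathbb{H}$-vector space that is complete for a norm with $\|av\|=|a|\|v\|=\|va\|$. $T$ is right linear if $T(ua+v)=T(u)a+T(v)$; for $a\in\mathbb{H}$, $(aT)v=a(Tv)$. $\mathcal{B}(V)$ is the set of bounded right linear operators on $V$; $\mathcal{I}$ is the identity. A strongly continuous group is a family $(\mathcal{Z}(t))_{t\in\mathbb{R}}\subset\mathcal{B}(V)$ with $\mathcal{Z}(0)=\mathcal{I}$, $\mathcal{Z}(t_1+t_2)=\mathcal{Z}(t_1)\mathcal{Z}(t_2)$ and $t\mapsto\mathcal{Z}(t)v$ continuous for every $v\in V$. Its infinitesimal generator is $Tv=\lim_{h\to0^+}\frac1h(\mathcal{Z}(h)v-v)$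 with domain $\mathcal{D}(T)$ the set of $v$ for which the limit exists; one writes $\mathcal{Z}_T(t)$ for $\mathcal{Z}(t)$. The $S$-spectrum $\sigma_S(T)$ is the complement in $\mathbb{H}$ of the set of $s\in\mathbb{H}$ such that $T^2-2\mathrm{Re}(s)T+|s|^2\mathcal{I}:\mathcal{D}(T^2)\to V$ is injective with dense range and has inverse in $\mathcal{B}(V)$. Fix constants $M>0$, $\omega\ge0$ with $\|\mathcal{Z}_T(t)\|\le Me^{\omega|t|}$ for all $t\in\mathbb{R}$ and $\sigma_S(T)\subset\{s:-\omega<\mathrm{Re}(s)<\omega\}$. A quaternionic measure on the Borel sets $\mathbf{B}(\mathbb{R})$ is a countably additive $\mu:\mathbf{B}(\mathbb{R})\to\mathbb{H}$; $|\mu|(A)=\sup\sum_i|\mu(A_i)|$ over countable measurable partitions of $A$ is its total variation, and $d\mu=h\,d|\mu|$ with $|h|=1$. Write $\int d\mu(t)\,F(t):=\int h(t)F(t)\,d|\mu|(t)$ (Bochner integral). $\mathbf{S}(T)$ is the set of quaternionic measures $\mu$ on $\mathbf{B}(\mathbb{R})$ with $\int_{\mathbb{R}}d|\mu|(t)\,e^{(\omega+\varepsilon)|t|}<\infty$ for some $\varepsilon=\varepsilon(\mu)>0$. Put $\mathcal{L}(\mu)(s)=\int_{\mathbb{R}}d\mu(t)\,e^{-st}$ for $-(\omega+\varepsilon)<\mathrm{Re}(s)<\omega+\varepsilon$, and $\mathbf{V}(T)=\{\mathcal{L}(\mu):\mu\in\mathbf{S}(T)\}$; sums and products of elements of $\mathbf{V}(T)$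 are taken on the common strip. For $f=\mathcal{L}(\mu)\in\mathbf{V}(T)$, $\mu\in\mathbf{S}(T)$, define $f(T)v=\int_{\mathbb{R}}d\mu(t)\,\mathcal{Z}_T(-t)v$, $v\in V$. A function $g\in\mathbf{V}(T)$ is intrinsic if $g(\overline{s})=\overline{g(s)}$ for all $s$ in its strip. *)

theory Defs
  imports "HOL-Analysis.Analysis"
begin

section \<open>Quaternions\<close>

datatype quat = Quat (qRe: real) (qI: real) (qJ: real) (qK: real)

lemma quat_eq_iff:
  "p = q \<longleftrightarrow> qRe p = qRe q \<and> qI p = qI q \<and> qJ p = qJ q \<and> qK p = qK q"
  by (auto intro: quat.expand)

instantiation quat :: ab_group_add
begin
definition "0 = Quat 0 0 0 0"
definition "p + q = Quat (qRe p + qRe q) (qI p + qI q) (qJ p + qJ q) (qK p + qK q)"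
definition "p - q = Quat (qRe p - qRe q) (qI p - qI q) (qJ p - qJ q) (qK p - qK q)"
definition "- q = Quat (- qRe q) (- qI q) (- qJ q) (- qK q)"
instance
  by standard
    (simp_all add: quat_eq_iff zero_quat_def plus_quat_def minus_quat_def uminus_quat_def)
end

instantiation quat :: real_vector
begin
definition "r *\<^sub>R q = Quat (r * qRe q) (r * qI q) (r * qJ q) (r * qK q)"
instance
  by standard (simp_all add: quat_eq_iff plus_quat_def scaleR_quat_def algebra_simps)
end

lemma quat_zero_sel [simp]: "qRe 0 = 0" "qI 0 = 0" "qJ 0 = 0" "qK 0 = 0"
  by (simp_all add: zero_quat_def)

lemma quat_add_sel [simp]:
  "qRe (p + q) = qRe p + qRe q" "qI (p + q) = qI p + qI q"
  "qJ (p + q) = qJ p + qJ q" "qK (p + q) = qK p + qK q"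
  by (simp_all add: plus_quat_def)

lemma quat_diff_sel [simp]:
  "qRe (p - q) = qRe p - qRe q" "qI (p - q) = qI p - qI q"
  "qJ (p - q) = qJ p - qJ q" "qK (p - q) = qK p - qK q"
  by (simp_all add: minus_quat_def)

lemma quat_minus_sel [simp]:
  "qRe (- q) = - qRe q" "qI (- q) = - qI q" "qJ (- q) = - qJ q" "qK (- q) = - qK q"
  by (simp_all add: uminus_quat_def)

lemma quat_scaleR_sel [simp]:
  "qRe (r *\<^sub>R q) = r * qRe q" "qI (r *\<^sub>R q) = r * qI q"
  "qJ (r *\<^sub>R q) = r * qJ q" "qK (r *\<^sub>R q) = r * qK q"
  by (simp_all add: scaleR_quat_def)

instantiation quat :: real_algebra_1
begin
definition "1 = Quat 1 0 0 0"
definition "p * q = Quat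
  (qRe p * qRe q - qI p * qI q - qJ p * qJ q - qK p * qK q)
  (qRe p * qI q + qI p * qRe q + qJ p * qK q - qK p * qJ q)
  (qRe p * qJ q - qI p * qK q + qJ p * qRe q + qK p * qI q)
  (qRe p * qK q + qI p * qJ q - qJ p * qI q + qK p * qRe q)"
instance
  by standard (simp_all add: quat_eq_iff one_quat_def times_quat_def algebra_simps)
end

lemma quat_one_sel [simp]: "qRe 1 = 1" "qI 1 = 0" "qJ 1 = 0" "qK 1 = 0"
  by (simp_all add: one_quat_def)

lemma quat_mult_sel:
  "qRe (p * q) = qRe p * qRe q - qI p * qI q - qJ p * qJ q - qK p * qK q"
  "qI (p * q) = qRe p * qI q + qI p * qRe q + qJ p * qK q - qK p * qJ q"
  "qJ (p * q) = qRe p * qJ q - qI p * qK q + qJ p * qRe q + qK p * qI q"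
  "qK (p * q) = qRe p * qK q + qI p * qJ q - qJ p * qI q + qK p * qRe q"
  by (simp_all add: times_quat_def)

definition qcnj :: "quat \<Rightarrow> quat"
  where "qcnj q = Quat (qRe q) (- qI q) (- qJ q) (- qK q)"

instantiation quat :: real_inner
begin
definition "inner p q = qRe p * qRe q + qI p * qI q + qJ p * qJ q + qK p * qK q" for p q :: quat
definition "norm q = sqrt (inner q q)" for q :: quat
definition "sgn q = q /\<^sub>R norm q" for q :: quat
definition "dist p q = norm (p - q)" for p q :: quat
definition "uniformity = (INF e\<in>{0 <..}. principal {(p, q :: quat). dist p q < e})"
definition "open (U :: quat set) \<longleftrightarrow>
  (\<forall>x\<in>U. eventually (\<lambda>(x', y). x' = x \<longrightarrow> y \<in> U) uniformity)"
instance
proof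
  fix p q r :: quat and c :: real
  show "inner q q = 0 \<longleftrightarrow> q = 0"
    by (simp add: inner_quat_def quat_eq_iff add_nonneg_eq_0_iff)
  show "inner p q = inner q p" "inner (p + q) r = inner p r + inner q r"
    "inner (c *\<^sub>R p) q = c * inner p q" "0 \<le> inner p p"
    by (simp_all add: inner_quat_def algebra_simps)
qed (simp_all only: norm_quat_def sgn_quat_def dist_quat_def uniformity_quat_def open_quat_def)
end

instantiation quat :: real_normed_div_algebra
begin
definition "inverse q = qcnj q /\<^sub>R (norm q)\<^sup>2"
definition "p div q = p * inverse q" for p q :: quat
instance
proof
  fix p q :: quat
  have norm_sq: "(norm p)\<^sup>2 = (qRe p)\<^sup>2 + (qI p)\<^sup>2 + (qJ p)\<^sup>2 + (qK p)\<^sup>2" for p :: quat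
    by (simp only: power2_norm_eq_inner inner_quat_def) (simp add: power2_eq_square)
  show "norm (p * q) = norm p * norm q"
  proof (rule power2_eq_imp_eq)
    show "(norm (p * q))\<^sup>2 = (norm p * norm q)\<^sup>2"
      unfolding power_mult_distrib norm_sq quat_mult_sel
      by (simp add: power2_eq_square algebra_simps)
  qed simp_all
  show "p div q = p * inverse q"
    by (rule divide_quat_def)
  have cnj_mult: "p * qcnj p = (norm p)\<^sup>2 *\<^sub>R 1" "qcnj p * p = (norm p)\<^sup>2 *\<^sub>R 1"
    by (simp_all add: norm_sq quat_eq_iff quat_mult_sel qcnj_def)
      (simp_all add: power2_eq_square)
  show "inverse (0 :: quat) = 0"
    by (simp add: inverse_quat_def quat_eq_iff qcnj_def)
  assume "p \<noteq> 0"
  then show "inverse p * p = 1" "p * inverse p = 1"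
    by (simp_all add: inverse_quat_def cnj_mult)
qed
end

instantiation quat :: euclidean_space
begin
definition "Basis = {Quat 1 0 0 0, Quat 0 1 0 0, Quat 0 0 1 0, Quat 0 0 0 1}"
instance
proof
  fix q u v :: quat
  show "(Basis :: quat set) \<noteq> {}" "finite (Basis :: quat set)"
    by (simp_all add: Basis_quat_def)
  show "inner u v = (if u = v then 1 else 0)" if "u \<in> Basis" "v \<in> Basis"
    using that unfolding Basis_quat_def inner_quat_def
    by (elim insertE emptyE) simp_all
  show "(\<forall>u\<in>Basis. inner q u = 0) \<longleftrightarrow> q = 0"
    unfolding Basis_quat_def inner_quat_def quat_eq_iff by simp
qed
end


section \<open>Two-sided quaternionic Banach spaces and their operators\<close>

text \<open>
  Real scalars act in the same way from both sides and give the underlying real Banach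
  space. This is no restriction: it follows from the bimodule laws and
  \<open>\<parallel>a v\<parallel> = \<bar>a\<bar> \<parallel>v\<parallel> = \<parallel>v a\<parallel>\<close>, since both actions agree on the rationals and are continuous
  in the scalar.
\<close>

class two_sided_quat_banach = banach +
  fixes qscaleL :: "quat \<Rightarrow> 'a \<Rightarrow> 'a" (infixr \<open>*\<^sub>l\<close> 75)
    and qscaleR :: "'a \<Rightarrow> quat \<Rightarrow> 'a" (infixl \<open>*\<^sub>r\<close> 76)
  assumes qscaleL_add_right: "a *\<^sub>l (v + w) = a *\<^sub>l v + a *\<^sub>l w"
    and qscaleL_add_left: "(a + b) *\<^sub>l v = a *\<^sub>l v + b *\<^sub>l v"
    and qscaleL_qscaleL: "a *\<^sub>l (b *\<^sub>l v) = (a * b) *\<^sub>l v"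
    and qscaleR_add_left: "(v + w) *\<^sub>r a = v *\<^sub>r a + w *\<^sub>r a"
    and qscaleR_add_right: "v *\<^sub>r (a + b) = v *\<^sub>r a + v *\<^sub>r b"
    and qscaleR_qscaleR: "(v *\<^sub>r a) *\<^sub>r b = v *\<^sub>r (a * b)"
    and qscaleL_qscaleR: "(a *\<^sub>l v) *\<^sub>r b = a *\<^sub>l (v *\<^sub>r b)"
    and qscaleL_of_real: "of_real c *\<^sub>l v = c *\<^sub>R v"
    and qscaleR_of_real: "v *\<^sub>r of_real c = c *\<^sub>R v"
    and norm_qscaleL: "norm (a *\<^sub>l v) = norm a * norm v"
    and norm_qscaleR: "norm (v *\<^sub>r a) = norm v * norm a"

instantiation quat :: two_sided_quat_banach
begin
definition "a *\<^sub>l v = a * v" for a v :: quat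
definition "v *\<^sub>r a = v * a" for a v :: quat
instance
  by standard
    (simp_all add: qscaleL_quat_def qscaleR_quat_def distrib_left distrib_right mult.assoc
      norm_mult of_real_def)
end

definition right_linear :: "('v::two_sided_quat_banach \<Rightarrow> 'v) \<Rightarrow> bool"
  where "right_linear A \<longleftrightarrow> (\<forall>u v a. A (u *\<^sub>r a + v) = A u *\<^sub>r a + A v)"

definition bounded_right_linear_operators :: "('v::two_sided_quat_banach \<Rightarrow> 'v) set"
  where "bounded_right_linear_operators =
    {A. right_linear A \<and> (\<exists>K. \<forall>v. norm (A v) \<le> K * norm v)}"

definition strongly_continuous_group :: "(real \<Rightarrow> 'v::two_sided_quat_banach \<Rightarrow> 'v) \<Rightarrow> bool"
  where "strongly_continuous_group Z \<longleftrightarrow>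
    (\<forall>t. Z t \<in> bounded_right_linear_operators) \<and>
    Z 0 = id \<and>
    (\<forall>t1 t2. Z (t1 + t2) = Z t1 \<circ> Z t2) \<and>
    (\<forall>v. continuous_on UNIV (\<lambda>t. Z t v))"

text \<open>
  An unbounded operator is given by its domain \<open>D\<close> and a function \<open>T\<close> whose values outside
  \<open>D\<close> are irrelevant.
\<close>

definition infinitesimal_generator ::
    "(real \<Rightarrow> 'v::two_sided_quat_banach \<Rightarrow> 'v) \<Rightarrow> 'v set \<Rightarrow> ('v \<Rightarrow> 'v) \<Rightarrow> bool"
  where "infinitesimal_generator Z D T \<longleftrightarrow>
    D = {v. \<exists>w. ((\<lambda>h. (1 / h) *\<^sub>R (Z h v - v)) \<longlongrightarrow> w) (at_right 0)} \<and>
    (\<forall>v\<in>D. ((\<lambda>h. (1 / h) *\<^sub>R (Z h v - v)) \<longlongrightarrow> T v) (at_right 0))"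

definition S_resolvent_set :: "'v::two_sided_quat_banach set \<Rightarrow> ('v \<Rightarrow> 'v) \<Rightarrow> quat set"
  where "S_resolvent_set D T =
    {s. let D2 = {v \<in> D. T v \<in> D};
            Q = (\<lambda>v. T (T v) - (2 * qRe s) *\<^sub>R T v + (norm s)\<^sup>2 *\<^sub>R v)
        in inj_on Q D2 \<and> closure (Q ` D2) = UNIV \<and>
           (\<exists>R \<in> bounded_right_linear_operators.
              (\<forall>v\<in>D2. R (Q v) = v) \<and> (\<forall>w. R w \<in> D2 \<and> Q (R w) = w))}"

definition S_spectrum :: "'v::two_sided_quat_banach set \<Rightarrow> ('v \<Rightarrow> 'v) \<Rightarrow> quat set"
  where "S_spectrum D T = - S_resolvent_set D T"


section \<open>Bochner integral without separability\<close>

text \<open>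
  The library's \<^const>\<open>has_bochner_integral\<close> demands a second countable codomain; the same
  definition, literally, makes sense in every normed space. The approximation by simple
  functions forces the integrand to be essentially separably valued.
\<close>

definition has_bochner :: "'a measure \<Rightarrow> ('a \<Rightarrow> 'b::real_normed_vector) \<Rightarrow> 'b \<Rightarrow> bool"
  where "has_bochner M f x \<longleftrightarrow>
    f \<in> borel_measurable M \<and>
    (\<exists>s. (\<forall>i. Bochner_Integration.simple_bochner_integrable M (s i)) \<and>
         (\<lambda>i. \<integral>\<^sup>+t. ennreal (norm (f t - s i t)) \<partial>M) \<longlonglongrightarrow> 0 \<and>
         (\<lambda>i. Bochner_Integration.simple_bochner_integral M (s i)) \<longlonglongrightarrow> x)"

lemma has_bochner_iff_has_bochner_integral:
  fixes f :: "'a \<Rightarrow> 'b::{real_normed_vector, second_countable_topology}"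
  shows "has_bochner M f x \<longleftrightarrow> has_bochner_integral M f x"
  by (auto simp: has_bochner_def has_bochner_integral.simps)

definition bochner :: "'a measure \<Rightarrow> ('a \<Rightarrow> 'b::real_normed_vector) \<Rightarrow> 'b"
  where "bochner M f = (if \<exists>x. has_bochner M f x then THE x. has_bochner M f x else 0)"


section \<open>Quaternionic measures\<close>

text \<open>
  As for the library's measures, the value on sets that are not measurable is \<open>0\<close>, so that
  two measures which agree on the Borel sets are equal.
\<close>

definition quat_measure :: "(real set \<Rightarrow> quat) \<Rightarrow> bool"
  where "quat_measure \<mu> \<longleftrightarrow>
    (\<forall>A::nat \<Rightarrow> real set. range A \<subseteq> sets borel \<longrightarrow> disjoint_family A \<longrightarrow>
      (\<lambda>i. \<mu> (A i)) sums \<mu> (\<Union>i. A i)) \<and>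
    (\<forall>A. A \<notin> sets borel \<longrightarrow> \<mu> A = 0)"

definition total_variation :: "(real set \<Rightarrow> quat) \<Rightarrow> real set \<Rightarrow> ennreal"
  where "total_variation \<mu> A =
    (SUP P \<in> {P::nat \<Rightarrow> real set. range P \<subseteq> sets borel \<and> disjoint_family P \<and> (\<Union>i. P i) = A}.
      \<Sum>i. ennreal (norm (\<mu> (P i))))"

definition variation_measure :: "(real set \<Rightarrow> quat) \<Rightarrow> real measure"
  where "variation_measure \<mu> = measure_of UNIV (sets borel) (total_variation \<mu>)"

text \<open>The density \<open>h\<close> in \<open>d\<mu> = h d\<bar>\<mu>\<bar>\<close>; it is determined \<open>\<bar>\<mu>\<bar>\<close>-almost everywhere.\<close>

definition polar_density :: "(real set \<Rightarrow> quat) \<Rightarrow> real \<Rightarrow> quat"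
  where "polar_density \<mu> = (SOME h. h \<in> borel_measurable borel \<and> (\<forall>t. norm (h t) = 1) \<and>
    (\<forall>A\<in>sets borel. \<mu> A = (LINT t:A|variation_measure \<mu>. h t)))"

definition quat_measure_integral ::
    "(real set \<Rightarrow> quat) \<Rightarrow> (real \<Rightarrow> 'v::two_sided_quat_banach) \<Rightarrow> 'v"
  where "quat_measure_integral \<mu> F =
    bochner (variation_measure \<mu>) (\<lambda>t. polar_density \<mu> t *\<^sub>l F t)"

definition laplace :: "(real set \<Rightarrow> quat) \<Rightarrow> quat \<Rightarrow> quat"
  where "laplace \<mu> s = quat_measure_integral \<mu> (\<lambda>t. exp (- (t *\<^sub>R s)))"


section \<open>The functional calculus\<close>

definition strip :: "real \<Rightarrow> quat set"
  where "strip r = {s. - r < qRe s \<and> qRe s < r}"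

definition exp_integrable :: "real \<Rightarrow> (real set \<Rightarrow> quat) \<Rightarrow> bool"
  where "exp_integrable r \<mu> \<longleftrightarrow>
    (\<integral>\<^sup>+t. ennreal (exp (r * \<bar>t\<bar>)) \<partial>variation_measure \<mu>) < \<infinity>"

definition S_measures :: "real \<Rightarrow> (real set \<Rightarrow> quat) set"
  where "S_measures \<omega> = {\<mu>. quat_measure \<mu> \<and> (\<exists>\<epsilon>>0. exp_integrable (\<omega> + \<epsilon>) \<mu>)}"

text \<open>
  The functions \<open>\<L>(\<mu>)\<close> have strips of different widths. They are encoded as total functions
  of which only the values on \<open>strip (\<omega> + \<epsilon>)\<close>, for some \<open>\<epsilon>\<close> admissible for \<open>\<mu>\<close>, matter; sums
  and products are then pointwise, and are elements of \<open>V_functions \<omega>\<close> because of their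
  values on a common strip.
\<close>

definition is_laplace_of :: "real \<Rightarrow> real \<Rightarrow> (quat \<Rightarrow> quat) \<Rightarrow> (real set \<Rightarrow> quat) \<Rightarrow> bool"
  where "is_laplace_of \<omega> \<epsilon> f \<mu> \<longleftrightarrow>
    \<epsilon> > 0 \<and> exp_integrable (\<omega> + \<epsilon>) \<mu> \<and> (\<forall>s\<in>strip (\<omega> + \<epsilon>). f s = laplace \<mu> s)"

definition V_functions :: "real \<Rightarrow> (quat \<Rightarrow> quat) set"
  where "V_functions \<omega> = {f. \<exists>\<mu>\<in>S_measures \<omega>. \<exists>\<epsilon>. is_laplace_of \<omega> \<epsilon> f \<mu>}"

text \<open>The measure \<open>\<mu>\<close> is unique, by injectivity of the Laplace transform on a strip.\<close>

definition functional_calculus ::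
    "real \<Rightarrow> (real \<Rightarrow> 'v::two_sided_quat_banach \<Rightarrow> 'v) \<Rightarrow> (quat \<Rightarrow> quat) \<Rightarrow> 'v \<Rightarrow> 'v"
  where "functional_calculus \<omega> Z f v =
    quat_measure_integral (THE \<mu>. \<mu> \<in> S_measures \<omega> \<and> (\<exists>\<epsilon>. is_laplace_of \<omega> \<epsilon> f \<mu>))
      (\<lambda>t. Z (- t) v)"

definition intrinsic_on :: "quat set \<Rightarrow> (quat \<Rightarrow> quat) \<Rightarrow> bool"
  where "intrinsic_on U g \<longleftrightarrow> (\<forall>s\<in>U. g (qcnj s) = qcnj (g s))"

end

theory Submission
  imports Defs "HOL-Probability.Levy"
begin

text \<open>
  The integral of a continuous, exponentially bounded function against \<open>\<mu>\<close> is the limit of its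
  Riemann sums \<open>\<Sum>\<^sub>y \<mu>(I\<^sub>y) F(y)\<close>, in which \<open>\<mu>\<close> itself occurs instead of its polar decomposition;
  part (i) is therefore linearity of finite sums. Comparing values of an intrinsic
  \<open>g = \<L>(\<nu>)\<close> at \<open>y u\<close> and \<open>- y u\<close>, for \<open>u\<close> one of the three imaginary units, shows that the
  \<open>u\<close>-component of \<open>\<nu>\<close> has vanishing Fourier transform, so \<open>\<nu>\<close> is real. Real values commute with
  the operators \<open>Z(- t)\<close>, and \<open>f(T) g(T)\<close> becomes integration against the convolution \<open>\<mu> * \<nu>\<close>.
  The same identity for the group \<open>v \<mapsto> e\<^sup>t\<^sup>s v\<close> on the quaternions is
  \<open>\<L>(\<mu> * \<nu>) = \<L>(\<mu>) \<L>(\<nu>)\<close>.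
\<close>

section \<open>Bochner integrals of quaternion-weighted functions\<close>

text \<open>Two obstacles shape the proof. \<open>V\<close> need not be separable, so sums of
  measurable functions and linearity of the Bochner integral need care; and the polar density of
  \<open>\<mu> + \<nu>\<close> has no usable relation to those of \<open>\<mu>\<close> and
  \<open>\<nu>\<close>. Riemann sums avoid both: they are linear in the measure before the limit is
  taken, and a single dominated convergence argument, \<open>has_bochner_fibre_limit\<close>, yields
  the integral together with its approximation. The polar density is a mere choice, so its existence
  must be proved, by Radon-Nikodym with respect to the variation itself. The calculus selects its
  measure by a definite description. Each identity therefore needs, besides a formula for integrals,
  an exponential moment of the new measure and injectivity of the Laplace transform. Injectivity is
  reduced to the uniqueness theorem for characteristic functions: a real density with vanishing
  Fourier integrals is added to the constant density 1, which gives two probability measures with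
  the same characteristic function.\<close>

abbreviation simple_bochner_integrable :: "'a measure \<Rightarrow> ('a \<Rightarrow> 'b::real_vector) \<Rightarrow> bool"
  where "simple_bochner_integrable \<equiv> Bochner_Integration.simple_bochner_integrable"

abbreviation simple_bochner_integral :: "'a measure \<Rightarrow> ('a \<Rightarrow> 'b::real_vector) \<Rightarrow> 'b"
  where "simple_bochner_integral \<equiv> Bochner_Integration.simple_bochner_integral"

lemma simple_function_in_count_space:
  assumes "simple_function M s"
  shows "s \<in> measurable M (count_space (s ` space M))"
  using simple_functionD(2)[OF assms] by (auto simp: measurable_def)

text \<open>In a space that is not second countable, sums and differences of measurable functions need not
  be measurable, but one simple summand suffices.\<close>

lemma measurable_compose_simple:
  assumes s: "simple_function M s" and f: "\<And>c. (\<lambda>x. f c x) \<in> measurable M N"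
  shows "(\<lambda>x. f (s x) x) \<in> measurable M N"
proof (rule measurable_compose_countable'[where f=f and g=s])
  show "s \<in> measurable M (count_space (s ` space M))"
    using s by (rule simple_function_in_count_space)
  show "countable (s ` space M)"
    using s by (simp add: simple_function_def countable_finite)
qed (rule f)

lemma borel_measurable_norm_diff_simple:
  fixes f :: "'a \<Rightarrow> 'b::real_normed_vector"
  assumes f: "f \<in> borel_measurable M" and s: "simple_function M s"
  shows "(\<lambda>x. norm (f x - s x)) \<in> borel_measurable M"
proof (rule measurable_compose_simple[OF s])
  fix c :: 'b
  have "continuous_on UNIV (\<lambda>y. norm (y - c))"
    by (intro continuous_intros)
  from measurable_compose[OF f borel_measurable_continuous_onI[OF this]]
  show "(\<lambda>x. norm (f x - c)) \<in> borel_measurable M" .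
qed

text \<open>Both simple functions are compared with \<open>f\<close>, whose own integral does not
  occur. Measurability of the two error norms rests on the simplicity of \<open>s\<close> and
  \<open>t\<close>, so the codomain may be any normed space.\<close>

lemma simple_bochner_integral_bounded':
  fixes f :: "'a \<Rightarrow> 'b::real_normed_vector"
  assumes f: "f \<in> borel_measurable M"
  assumes s: "simple_bochner_integrable M s" and t: "simple_bochner_integrable M t"
  shows "ennreal (norm (simple_bochner_integral M s - simple_bochner_integral M t)) \<le>
    (\<integral>\<^sup>+ x. norm (f x - s x) \<partial>M) + (\<integral>\<^sup>+ x. norm (f x - t x) \<partial>M)"
proof -
  have [measurable]: "(\<lambda>x. norm (f x - s x)) \<in> borel_measurable M"
    "(\<lambda>x. norm (f x - t x)) \<in> borel_measurable M"
    using s t by (auto intro!: borel_measurable_norm_diff_simple f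
        elim: simple_bochner_integrable.cases)
  have "ennreal (norm (simple_bochner_integral M s - simple_bochner_integral M t)) =
      norm (simple_bochner_integral M (\<lambda>x. s x - t x))"
    using s t by (subst simple_bochner_integral_diff) auto
  also have "\<dots> \<le> simple_bochner_integral M (\<lambda>x. norm (s x - t x))"
    using simple_bochner_integrable_compose2[of "(-)" M "s" "t"] s t
    by (auto intro!: simple_bochner_integral_norm_bound)
  also have "\<dots> = (\<integral>\<^sup>+x. norm (s x - t x) \<partial>M)"
    using simple_bochner_integrable_compose2[of "\<lambda>x y. norm (x - y)" M "s" "t"] s t
    by (auto intro!: simple_bochner_integral_eq_nn_integral)
  also have "\<dots> \<le> (\<integral>\<^sup>+x. ennreal (norm (f x - s x)) + ennreal (norm (f x - t x)) \<partial>M)"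
  proof (rule nn_integral_mono)
    fix x
    have "norm (s x - t x) \<le> norm (f x - s x) + norm (f x - t x)"
      by (metis dual_order.refl norm_diff_triangle_le norm_minus_commute)
    then show "ennreal (norm (s x - t x)) \<le> ennreal (norm (f x - s x)) + ennreal (norm (f x - t x))"
      by (metis ennreal_leI ennreal_plus norm_ge_zero)
  qed
  also have "\<dots> = (\<integral>\<^sup>+ x. norm (f x - s x) \<partial>M) + (\<integral>\<^sup>+ x. norm (f x - t x) \<partial>M)"
    by (rule nn_integral_add) auto
  finally show ?thesis .
qed

text \<open>Approximating sequences of the same function are close to each other in L1, so their
  integrals merge. This later identifies the limits of two different discretizations in the
  plane.\<close>

lemma has_bochner_unique:
  assumes "has_bochner M f x" "has_bochner M f y"
  shows "x = y"
proof -
  from assms(1) obtain s where f: "f \<in> borel_measurable M"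
    and s: "\<And>i. simple_bochner_integrable M (s i)"
      "(\<lambda>i. \<integral>\<^sup>+t. ennreal (norm (f t - s i t)) \<partial>M) \<longlonglongrightarrow> 0"
      "(\<lambda>i. simple_bochner_integral M (s i)) \<longlonglongrightarrow> x"
    unfolding has_bochner_def by blast
  from assms(2) obtain t where t: "\<And>i. simple_bochner_integrable M (t i)"
      "(\<lambda>i. \<integral>\<^sup>+u. ennreal (norm (f u - t i u)) \<partial>M) \<longlonglongrightarrow> 0"
      "(\<lambda>i. simple_bochner_integral M (t i)) \<longlonglongrightarrow> y"
    unfolding has_bochner_def by blast
  have "(\<lambda>i. ennreal (norm (simple_bochner_integral M (s i) - simple_bochner_integral M (t i))))
      \<longlonglongrightarrow> 0"
  proof (rule tendsto_sandwich[OF _ _ tendsto_const])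
    show "\<forall>\<^sub>F i in sequentially.
        ennreal (norm (simple_bochner_integral M (s i) - simple_bochner_integral M (t i)))
          \<le> (\<integral>\<^sup>+u. norm (f u - s i u) \<partial>M) + (\<integral>\<^sup>+u. norm (f u - t i u) \<partial>M)"
      by (intro always_eventually allI simple_bochner_integral_bounded' f s t)
    show "(\<lambda>i. (\<integral>\<^sup>+u. norm (f u - s i u) \<partial>M) + (\<integral>\<^sup>+u. norm (f u - t i u) \<partial>M))
        \<longlonglongrightarrow> 0"
      using tendsto_add[OF s(2) t(2)] by simp
  qed simp
  then have "(\<lambda>i. norm (simple_bochner_integral M (s i) - simple_bochner_integral M (t i))) \<longlonglongrightarrow> 0"
    by (simp flip: ennreal_0)
  moreover have "(\<lambda>i. norm (simple_bochner_integral M (s i) - simple_bochner_integral M (t i)))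
      \<longlonglongrightarrow> norm (x - y)"
    by (intro tendsto_intros s t)
  ultimately show ?thesis
    using LIMSEQ_unique by fastforce
qed

lemma bochner_eq: "has_bochner M f x \<Longrightarrow> bochner M f = x"
  unfolding bochner_def using has_bochner_unique by (auto intro!: the_equality)

lemma bounded_bilinear_qscaleL:
  "bounded_bilinear ((*\<^sub>l) :: quat \<Rightarrow> 'v \<Rightarrow> 'v::two_sided_quat_banach)"
proof
  fix a b :: quat and v w :: 'v and r :: real
  \<comment> \<open>Real scalars are central in the quaternions: homogeneity in the second slot
    moves \<open>r\<close> across \<open>a\<close> and needs both factorizations.\<close>
  have r: "r *\<^sub>R a = of_real r * a" "r *\<^sub>R a = a * of_real r"
    by (simp_all add: of_real_def)
  show "(r *\<^sub>R a) *\<^sub>l v = r *\<^sub>R (a *\<^sub>l v)"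
    by (metis qscaleL_of_real qscaleL_qscaleL r(1))
  show "a *\<^sub>l (r *\<^sub>R v) = r *\<^sub>R (a *\<^sub>l v)"
    by (metis qscaleL_of_real qscaleL_qscaleL r)
  show "\<exists>K. \<forall>a (v::'v). norm (a *\<^sub>l v) \<le> norm a * norm v * K"
    by (rule exI[of _ 1]) (simp add: norm_qscaleL)
qed (simp_all add: qscaleL_add_left qscaleL_add_right)

interpretation qscaleL: bounded_bilinear "(*\<^sub>l) :: quat \<Rightarrow> 'v \<Rightarrow> 'v::two_sided_quat_banach"
  by (rule bounded_bilinear_qscaleL)

section \<open>Integrals grouped by the fibres of a simple map\<close>

lemma simple_bochner_integrable_finite:
  "finite_measure M \<Longrightarrow> simple_function M f \<Longrightarrow> simple_bochner_integrable M f"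
  by (auto intro!: simple_bochner_integrable.intros simp: finite_measure.emeasure_finite)

lemma simple_bochner_integral_sum:
  assumes "finite_measure M" "finite I" "\<And>i. i \<in> I \<Longrightarrow> simple_function M (f i)"
  shows "simple_bochner_integral M (\<lambda>x. \<Sum>i\<in>I. f i x) = (\<Sum>i\<in>I. simple_bochner_integral M (f i))"
  using assms(2,3)
proof (induction I)
  case empty
  show ?case
    by (auto simp: simple_bochner_integral_def intro!: sum.neutral)
next
  case (insert i I)
  then show ?case
    by (simp add: simple_bochner_integral_add simple_bochner_integrable_finite assms(1)
        simple_function_sum)
qed

lemma simple_bochner_integral_cong:
  assumes "\<And>x. x \<in> space M \<Longrightarrow> f x = g x"
  shows "simple_bochner_integral M f = simple_bochner_integral M g"
  unfolding simple_bochner_integral_def using assms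
  by (auto intro!: sum.cong arg_cong2[where f=scaleR] arg_cong[where f="measure M"])

lemma sum_fibre_indicator:
  assumes "simple_function M D" "x \<in> space M"
  shows "(\<Sum>y\<in>D ` space M. indicator (D -` {y} \<inter> space M) x *\<^sub>R c y) = (c (D x) :: 'b::real_vector)"
proof -
  have "(\<Sum>y\<in>D ` space M. indicator (D -` {y} \<inter> space M) x *\<^sub>R c y)
      = (\<Sum>y\<in>D ` space M. if y = D x then c y else 0)"
    using assms by (intro sum.cong) (auto simp: indicator_def)
  also have "\<dots> = c (D x)"
    using assms by (simp add: simple_function_def)
  finally show ?thesis .
qed

text \<open>On a fibre of \<open>D\<close> the factor \<open>F (D x)\<close> is constant, so only
  \<open>h\<close> is integrated there. When \<open>h\<close> is replaced by a polar density, the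
  fibre integrals become values of the quaternionic measure.\<close>

lemma simple_bochner_integral_fibres:
  fixes h :: "'a \<Rightarrow> quat" and F :: "'b \<Rightarrow> 'v::two_sided_quat_banach"
  assumes "finite_measure M" and h: "simple_function M h" and D: "simple_function M D"
  shows "simple_bochner_integral M (\<lambda>x. h x *\<^sub>l F (D x)) =
    (\<Sum>y\<in>D ` space M. (LINT x:D -` {y} \<inter> space M|M. h x) *\<^sub>l F y)"
proof -
  have fin: "finite (D ` space M)" and [measurable]: "D -` {y} \<inter> space M \<in> sets M" for y
    using D by (auto simp: simple_functionD)
  have ind: "simple_function M (indicator (D -` {y} \<inter> space M) :: 'a \<Rightarrow> real)" for y
    by (intro simple_function_indicator) simp
  have hind: "simple_function M (\<lambda>x. indicator (D -` {y} \<inter> space M) x *\<^sub>R h x)" for y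
    using ind h by (rule simple_function_compose2)
  have "(LINT x:D -` {y} \<inter> space M|M. h x) *\<^sub>l F y =
      simple_bochner_integral M (\<lambda>x. (indicator (D -` {y} \<inter> space M) x *\<^sub>R h x) *\<^sub>l F y)" for y
  proof -
    have "(LINT x:D -` {y} \<inter> space M|M. h x) =
        simple_bochner_integral M (\<lambda>x. indicator (D -` {y} \<inter> space M) x *\<^sub>R h x)"
      unfolding set_lebesgue_integral_def
      by (intro has_bochner_integral_integral_eq has_bochner_integral_simple_bochner_integrable
          simple_bochner_integrable_finite assms(1) hind)
    then show ?thesis
      using simple_bochner_integral_linear[of "\<lambda>a. a *\<^sub>l F y"
          M "\<lambda>x. indicator (D -` {y} \<inter> space M) x *\<^sub>R h x"]
      by (simp add: bounded_linear.linear qscaleL.bounded_linear_left hind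
          simple_bochner_integrable_finite assms(1))
  qed
  then have "(\<Sum>y\<in>D ` space M. (LINT x:D -` {y} \<inter> space M|M. h x) *\<^sub>l F y) =
      simple_bochner_integral M
        (\<lambda>x. \<Sum>y\<in>D ` space M. (indicator (D -` {y} \<inter> space M) x *\<^sub>R h x) *\<^sub>l F y)"
    by (subst simple_bochner_integral_sum)
      (auto intro!: assms(1) fin simple_function_compose1[OF hind, where g="\<lambda>a. a *\<^sub>l F _"])
  also have "\<dots> = simple_bochner_integral M (\<lambda>x. h x *\<^sub>l F (D x))"
    using sum_fibre_indicator[OF D, of _ "\<lambda>y. h _ *\<^sub>l F y"]
    by (intro simple_bochner_integral_cong) (simp add: qscaleL.scaleR_left)
  finally show ?thesis ..
qed

text \<open>Serves twice: with the error of a simple approximation in place of \<open>h\<close>, and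
  to bound Riemann sums uniformly in the mesh.\<close>

lemma norm_fibre_sum_le:
  fixes h :: "'a \<Rightarrow> quat" and F :: "'b \<Rightarrow> 'v::two_sided_quat_banach"
  assumes "finite_measure M" and h: "integrable M h" and D: "simple_function M D"
  shows "norm (\<Sum>y\<in>D ` space M. (LINT x:D -` {y} \<inter> space M|M. h x) *\<^sub>l F y)
    \<le> (LINT x|M. norm (h x) * norm (F (D x)))"
proof -
  have fin: "finite (D ` space M)" and [measurable]: "D -` {y} \<inter> space M \<in> sets M" for y
    using D by (auto simp: simple_functionD)
  have int: "integrable M (\<lambda>x. indicator (D -` {y} \<inter> space M) x *\<^sub>R (norm (h x) * norm (F y)))" for y
    using h by (intro integrable_mult_indicator integrable_mult_left integrable_norm) auto
  have "norm (\<Sum>y\<in>D ` space M. (LINT x:D -` {y} \<inter> space M|M. h x) *\<^sub>l F y)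
      \<le> (\<Sum>y\<in>D ` space M. norm (LINT x:D -` {y} \<inter> space M|M. h x) * norm (F y))"
    using norm_sum by (metis (no_types, lifting) norm_qscaleL sum.cong)
  also have "\<dots> \<le> (\<Sum>y\<in>D ` space M.
      (LINT x|M. indicator (D -` {y} \<inter> space M) x *\<^sub>R (norm (h x) * norm (F y))))"
  proof (rule sum_mono)
    fix y
    have "norm (LINT x:D -` {y} \<inter> space M|M. h x)
        \<le> (LINT x|M. norm (indicator (D -` {y} \<inter> space M) x *\<^sub>R h x))"
      unfolding set_lebesgue_integral_def by (rule integral_norm_bound)
    also have "\<dots> = (LINT x|M. indicator (D -` {y} \<inter> space M) x * norm (h x))"
      by (intro Bochner_Integration.integral_cong) auto
    finally have "norm (LINT x:D -` {y} \<inter> space M|M. h x) * norm (F y)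
        \<le> (LINT x|M. indicator (D -` {y} \<inter> space M) x * norm (h x)) * norm (F y)"
      by (rule mult_right_mono) simp
    also have "\<dots> = (LINT x|M. indicator (D -` {y} \<inter> space M) x *\<^sub>R (norm (h x) * norm (F y)))"
      by (subst integral_mult_left_zero[symmetric]) (simp add: mult.assoc)
    finally show "norm (LINT x:D -` {y} \<inter> space M|M. h x) * norm (F y)
        \<le> (LINT x|M. indicator (D -` {y} \<inter> space M) x *\<^sub>R (norm (h x) * norm (F y)))" .
  qed
  also have "\<dots> = (LINT x|M. (\<Sum>y\<in>D ` space M.
      indicator (D -` {y} \<inter> space M) x *\<^sub>R (norm (h x) * norm (F y))))"
    using int by (subst Bochner_Integration.integral_sum) auto
  also have "\<dots> = (LINT x|M. norm (h x) * norm (F (D x)))"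
    using sum_fibre_indicator[OF D, of _ "\<lambda>y. norm (h _) * norm (F y)"]
    by (intro Bochner_Integration.integral_cong) auto
  finally show ?thesis .
qed

text \<open>Only the argument of \<open>F\<close> is discretized in the fibre sums; \<open>h\<close>
  is integrated exactly. The proof passes through simple functions in which \<open>h\<close> is
  approximated too, and shows that this second approximation does not change the limit.\<close>

lemma has_bochner_fibre_limit:
  fixes h :: "'a \<Rightarrow> quat" and F :: "'b \<Rightarrow> 'v::two_sided_quat_banach" and D :: "nat \<Rightarrow> 'a \<Rightarrow> 'b"
  assumes M: "finite_measure M"
    and h[measurable]: "h \<in> borel_measurable M" and h1: "\<And>x. norm (h x) \<le> 1"
    and D: "\<And>n. simple_function M (D n)"
    and lim: "\<And>x. x \<in> space M \<Longrightarrow> (\<lambda>n. F (D n x)) \<longlonglongrightarrow> f x"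
    and bound: "\<And>n x. x \<in> space M \<Longrightarrow> norm (F (D n x)) \<le> w x"
    and w: "integrable M w"
  obtains x where "has_bochner M (\<lambda>x. h x *\<^sub>l f x) x"
    "(\<lambda>n. \<Sum>y\<in>D n ` space M. (LINT x:D n -` {y} \<inter> space M|M. h x) *\<^sub>l F y) \<longlonglongrightarrow> x"
proof -
  interpret finite_measure M by (rule M)
  have [measurable]: "w \<in> borel_measurable M"
    using w by simp
  obtain k where k: "\<And>i. simple_function M (k i)" "\<And>x. x \<in> space M \<Longrightarrow> (\<lambda>i. k i x) \<longlonglongrightarrow> h x"
    "\<And>i x. x \<in> space M \<Longrightarrow> norm (k i x) \<le> 2 * norm (h x)"
    using borel_measurable_implies_sequence_metric[OF h, of 0] unfolding dist_norm diff_0_right by blast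
  have k2: "norm (k i x) \<le> 2" if "x \<in> space M" for i x
    using k(3)[OF that, of i] h1[of x] by linarith
  have w0: "0 \<le> w x" if "x \<in> space M" for x
    using bound[OF that, of 0] norm_ge_zero order_trans by blast
  have kint: "integrable M (k i)" for i
    using k(1) k2 by (intro integrable_const_bound[of _ 2])
      (auto intro: borel_measurable_simple_function)
  have hint: "integrable M h"
    using h1 by (intro integrable_const_bound[of _ 1]) auto
  \<comment> \<open>\<open>F (D n x)\<close> is already simple but \<open>h\<close> is not, so a
    simple \<open>k n\<close> replaces it.\<close>
  define s where "s n x = k n x *\<^sub>l F (D n x)" for n x
  define g where "g x = h x *\<^sub>l f x" for x
  have s: "simple_function M (s n)" for n
    unfolding s_def using k(1) D by (rule simple_function_compose2)
  have sg: "(\<lambda>n. s n x) \<longlonglongrightarrow> g x" if "x \<in> space M" for x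
    unfolding s_def g_def using k(2) lim that by (intro qscaleL.tendsto) auto
  have g[measurable]: "g \<in> borel_measurable M"
    using sg by (rule borel_measurable_LIMSEQ_metric[rotated])
      (auto intro: borel_measurable_simple_function s)
  have s2: "norm (s n x) \<le> 2 * w x" if "x \<in> space M" for n x
    unfolding s_def norm_qscaleL using k2 bound that w0 by (intro mult_mono) auto
  have g2: "norm (g x) \<le> 2 * w x" if "x \<in> space M" for x
    using LIMSEQ_le_const2[OF tendsto_norm[OF sg[OF that]], of "2 * w x"] s2[OF that] by auto
  have lim0: "(\<lambda>n. \<integral>\<^sup>+x. ennreal (norm (g x - s n x)) \<partial>M) \<longlonglongrightarrow> 0"
  proof -
    have "(\<lambda>n. \<integral>\<^sup>+x. ennreal (norm (g x - s n x)) \<partial>M) \<longlonglongrightarrow> (\<integral>\<^sup>+x. 0 \<partial>M)"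
    \<comment> \<open>The dominating function 4 w adds the bounds 2 w for \<open>g\<close> and 2 w
      for \<open>s n\<close>.\<close>
    proof (rule nn_integral_dominated_convergence[where w="\<lambda>x. ennreal (4 * w x)"])
      show "(\<lambda>x. ennreal (norm (g x - s n x))) \<in> borel_measurable M" for n
        using borel_measurable_norm_diff_simple[OF g s] by simp
      show "AE x in M. ennreal (norm (g x - s n x)) \<le> ennreal (4 * w x)" for n
        using s2 g2 by (auto intro!: AE_I2 ennreal_leI order_trans[OF norm_triangle_ineq4])
          (smt (verit))
      show "(\<integral>\<^sup>+x. ennreal (4 * w x) \<partial>M) < \<infinity>"
        using w w0 by (subst nn_integral_eq_integral) (auto intro!: AE_I2)
      show "AE x in M. (\<lambda>n. ennreal (norm (g x - s n x))) \<longlonglongrightarrow> 0"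
      proof (rule AE_I2)
        fix x assume "x \<in> space M"
        then have "(\<lambda>n. norm (g x - s n x)) \<longlonglongrightarrow> norm (g x - g x)"
          by (intro tendsto_intros sg)
        then show "(\<lambda>n. ennreal (norm (g x - s n x))) \<longlonglongrightarrow> 0"
          by (simp flip: ennreal_0)
      qed
    qed auto
    then show ?thesis
      by simp
  qed
  let ?I = "\<lambda>n. simple_bochner_integral M (s n)"
  \<comment> \<open>Closeness to \<open>g\<close> in L1 makes the integrals a Cauchy sequence;
    completeness of the space then supplies the value of the integral.\<close>
  have "Cauchy ?I"
  proof (rule metric_CauchyI)
    fix e :: real assume "e > 0"
    then have "\<forall>\<^sub>F n in sequentially. (\<integral>\<^sup>+x. ennreal (norm (g x - s n x)) \<partial>M) < ennreal (e / 2)"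
      using order_tendstoD(2)[OF lim0, of "ennreal (e / 2)"] by simp
    then obtain N where N: "\<And>n. n \<ge> N \<Longrightarrow> (\<integral>\<^sup>+x. ennreal (norm (g x - s n x)) \<partial>M) < ennreal (e / 2)"
      by (auto simp: eventually_sequentially)
    have "dist (?I i) (?I j) < e" if "i \<ge> N" "j \<ge> N" for i j
    proof -
      have "ennreal (dist (?I i) (?I j)) \<le> (\<integral>\<^sup>+x. ennreal (norm (g x - s i x)) \<partial>M)
          + (\<integral>\<^sup>+x. ennreal (norm (g x - s j x)) \<partial>M)"
        unfolding dist_norm
        by (intro simple_bochner_integral_bounded' g simple_bochner_integrable_finite M s)
      also have "\<dots> < ennreal (e / 2) + ennreal (e / 2)"
        by (intro add_strict_mono N that)
      also have "\<dots> = ennreal e"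
        using \<open>e > 0\<close> by (simp flip: ennreal_plus)
      finally show ?thesis
        using \<open>e > 0\<close> by (simp add: ennreal_less_iff)
    qed
    then show "\<exists>N. \<forall>i\<ge>N. \<forall>j\<ge>N. dist (?I i) (?I j) < e"
      by blast
  qed
  then obtain x where x: "?I \<longlonglongrightarrow> x"
    by (auto simp: Cauchy_convergent_iff convergent_def)
  have "has_bochner M g x"
    unfolding has_bochner_def
    using g s lim0 x simple_bochner_integrable_finite[OF M] by blast
  moreover
  let ?S = "\<lambda>n. \<Sum>y\<in>D n ` space M. (LINT x:D n -` {y} \<inter> space M|M. h x) *\<^sub>l F y"
  \<comment> \<open>Both sums use the same samples of \<open>F\<close>; their weights differ by the
    fibre integrals of \<open>h - k n\<close>.\<close>
  have "(\<lambda>n. ?S n - ?I n) \<longlonglongrightarrow> 0"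
  proof (rule tendsto_norm_zero_cancel, rule tendsto_sandwich[OF _ _ tendsto_const])
    show "\<forall>\<^sub>F n in sequentially. norm (?S n - ?I n)
        \<le> (LINT x|M. norm (h x - k n x) * norm (F (D n x)))"
    proof (intro always_eventually allI)
      fix n
      have [measurable]: "D n -` {y} \<inter> space M \<in> sets M" for y
        using D by (auto simp: simple_functionD)
      have "?S n - ?I n = (\<Sum>y\<in>D n ` space M. (LINT x:D n -` {y} \<inter> space M|M. h x - k n x) *\<^sub>l F y)"
        unfolding s_def simple_bochner_integral_fibres[OF M k(1) D] sum_subtractf[symmetric]
        by (intro sum.cong refl, subst set_integral_diff(2))
          (auto simp: set_integrable_def qscaleL.diff_left
            intro!: integrable_mult_indicator hint kint)
      then show "norm (?S n - ?I n) \<le> (LINT x|M. norm (h x - k n x) * norm (F (D n x)))"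
        using norm_fibre_sum_le[OF M Bochner_Integration.integrable_diff[OF hint kint] D] by simp
    qed
    have "(\<lambda>n. LINT x|M. norm (h x - k n x) * norm (F (D n x))) \<longlonglongrightarrow> (LINT x|M. 0)"
    \<comment> \<open>Here 3 = 1 + 2, from the bounds 1 for \<open>h\<close> and 2 for
      \<open>k n\<close>.\<close>
    proof (rule integral_dominated_convergence[where w="\<lambda>x. 3 * w x"])
      show "(\<lambda>x. norm (h x - k n x) * norm (F (D n x))) \<in> borel_measurable M" for n
        using k(1)[of n] simple_function_compose1[OF D, of "\<lambda>y. norm (F y)" n]
        by (auto dest!: borel_measurable_simple_function)
      show "AE x in M. (\<lambda>n. norm (h x - k n x) * norm (F (D n x))) \<longlonglongrightarrow> 0"
      proof (rule AE_I2)
        fix x assume "x \<in> space M"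
        then have "(\<lambda>n. norm (h x - k n x) * norm (F (D n x))) \<longlonglongrightarrow> norm (h x - h x) * norm (f x)"
          by (intro tendsto_intros k lim)
        then show "(\<lambda>n. norm (h x - k n x) * norm (F (D n x))) \<longlonglongrightarrow> 0"
          by simp
      qed
      show "AE x in M. norm (norm (h x - k n x) * norm (F (D n x))) \<le> 3 * w x" for n
      proof (rule AE_I2)
        fix x assume x: "x \<in> space M"
        have "norm (h x - k n x) \<le> 3"
          using norm_triangle_ineq4[of "h x" "k n x"] h1[of x] k2[OF x, of n] by linarith
        then have "norm (h x - k n x) * norm (F (D n x)) \<le> 3 * w x"
          using bound[OF x, of n] w0[OF x] by (intro mult_mono) auto
        then show "norm (norm (h x - k n x) * norm (F (D n x))) \<le> 3 * w x"
          by simp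
      qed
    qed (use w in auto)
    then show "(\<lambda>n. LINT x|M. norm (h x - k n x) * norm (F (D n x))) \<longlonglongrightarrow> 0"
      by simp
  qed simp
  from tendsto_add[OF this x] have "?S \<longlonglongrightarrow> x"
    by simp
  ultimately show ?thesis
    using that unfolding g_def by blast
qed

section \<open>Total variation and polar decomposition\<close>

lemma quat_measure_sums:
  assumes "quat_measure \<mu>" "\<And>i::nat. A i \<in> sets borel" "disjoint_family A"
  shows "(\<lambda>i. \<mu> (A i)) sums \<mu> (\<Union>i. A i)"
  using assms unfolding quat_measure_def by blast

lemma quat_measure_not_borel: "quat_measure \<mu> \<Longrightarrow> A \<notin> sets borel \<Longrightarrow> \<mu> A = 0"
  unfolding quat_measure_def by blast

lemma quat_measure_empty:
  assumes "quat_measure \<mu>"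
  shows "\<mu> {} = 0"
proof -
  \<comment> \<open>A constant series converges only for the constant 0.\<close>
  have "(\<lambda>i::nat. \<mu> {}) sums \<mu> (\<Union>i::nat. {})"
    using assms by (rule quat_measure_sums) (auto simp: disjoint_family_on_def)
  then show ?thesis
    using summable_const_iff sums_summable by blast
qed

lemma borel_partition_of_pair:
  assumes "A \<in> sets borel" "B \<in> sets borel" "A \<inter> B = {}"
  shows "(\<lambda>i::nat. if i = 0 then A else if i = 1 then B else {}) \<in>
    {P. range P \<subseteq> sets borel \<and> disjoint_family P \<and> (\<Union>i. P i) = A \<union> B}"
  using assms by (auto simp: disjoint_family_on_def split: if_splits)

lemma norm_le_total_variation:
  assumes "quat_measure \<mu>" "A \<in> sets borel"
  shows "ennreal (norm (\<mu> A)) \<le> total_variation \<mu> A"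
proof -
  \<comment> \<open>The redundant case keeps the shape of \<open>borel_partition_of_pair\<close>
    with an empty second set.\<close>
  let ?P = "\<lambda>i::nat. if i = 0 then A else if i = 1 then {} else {}"
  have "ennreal (norm (\<mu> A)) = (\<Sum>i. ennreal (norm (\<mu> (?P i))))"
    by (subst suminf_finite[of "{0}"]) (auto simp: quat_measure_empty assms)
  also have "\<dots> \<le> total_variation \<mu> A"
    unfolding total_variation_def
    using borel_partition_of_pair[of A "{}"] assms by (intro SUP_upper) auto
  finally show ?thesis .
qed

lemma total_variation_empty:
  assumes "quat_measure \<mu>"
  shows "total_variation \<mu> {} = 0"
  unfolding total_variation_def
proof (intro antisym SUP_least)
  fix P assume "P \<in> {P::nat \<Rightarrow> real set. range P \<subseteq> sets borel \<and> disjoint_family P \<and> (\<Union>i. P i) = {}}"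
  then have "P i = {}" for i by auto
  then show "(\<Sum>i. ennreal (norm (\<mu> (P i)))) \<le> 0"
    by (simp add: quat_measure_empty assms)
qed simp

lemma norm_sums_le_suminf:
  fixes f :: "nat \<Rightarrow> 'a::real_normed_vector"
  assumes "f sums s"
  shows "ennreal (norm s) \<le> (\<Sum>i. ennreal (norm (f i)))"
proof (rule LIMSEQ_le_const2)
  show "(\<lambda>n. ennreal (norm (\<Sum>i<n. f i))) \<longlonglongrightarrow> ennreal (norm s)"
    using assms unfolding sums_def by (intro tendsto_intros)
  have "ennreal (norm (\<Sum>i<n. f i)) \<le> (\<Sum>i. ennreal (norm (f i)))" for n
  proof -
    have "ennreal (norm (\<Sum>i<n. f i)) \<le> (\<Sum>i<n. ennreal (norm (f i)))"
      by (simp add: norm_sum ennreal_leI)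
    also have "\<dots> \<le> (\<Sum>i. ennreal (norm (f i)))"
      by (rule sum_le_suminf) auto
    finally show ?thesis .
  qed
  then show "\<exists>N. \<forall>n\<ge>N. ennreal (norm (\<Sum>i<n. f i)) \<le> (\<Sum>i. ennreal (norm (f i)))"
    by blast
qed

lemma suminf_swap_ennreal:
  fixes f :: "nat \<Rightarrow> nat \<Rightarrow> ennreal"
  shows "(\<Sum>i. \<Sum>j. f i j) = (\<Sum>j. \<Sum>i. f i j)"
proof -
  have "(\<Sum>i. \<Sum>j. f i j) = (\<integral>\<^sup>+i. (\<Sum>j. f i j) \<partial>count_space UNIV)"
    by (simp add: nn_integral_count_space_nat)
  also have "\<dots> = (\<Sum>j. \<integral>\<^sup>+i. f i j \<partial>count_space UNIV)"
    by (rule nn_integral_suminf) auto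
  finally show ?thesis
    by (simp add: nn_integral_count_space_nat)
qed

text \<open>A partition \<open>P\<close> of the union is cut along the sets \<open>E i\<close>. The
  triangle inequality for series enlarges the sum, and after interchanging the summations the pieces
  inside a fixed \<open>E i\<close> form a partition of it.\<close>

lemma total_variation_countably_subadditive:
  assumes \<mu>: "quat_measure \<mu>" and E: "\<And>i::nat. E i \<in> sets borel" "disjoint_family E"
  shows "total_variation \<mu> (\<Union>i. E i) \<le> (\<Sum>i. total_variation \<mu> (E i))"
  unfolding total_variation_def[of \<mu> "\<Union>i. E i"]
proof (rule SUP_least)
  fix P :: "nat \<Rightarrow> real set"
  assume "P \<in> {P. range P \<subseteq> sets borel \<and> disjoint_family P \<and> (\<Union>i. P i) = (\<Union>i. E i)}"
  then have P: "\<And>j. P j \<in> sets borel" "disjoint_family P" "(\<Union>i. P i) = (\<Union>i. E i)"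
    by auto
  have "(\<Sum>j. ennreal (norm (\<mu> (P j)))) \<le> (\<Sum>j. \<Sum>i. ennreal (norm (\<mu> (P j \<inter> E i))))"
  proof (rule suminf_le)
    fix j
    have "(\<lambda>i. \<mu> (P j \<inter> E i)) sums \<mu> (\<Union>i. P j \<inter> E i)"
    proof (rule quat_measure_sums[OF \<mu>])
      show "disjoint_family (\<lambda>i. P j \<inter> E i)"
        using E(2) unfolding disjoint_family_on_def by blast
    qed (use E P in auto)
    also have "(\<Union>i. P j \<inter> E i) = P j"
      using P(3) by auto
    finally show "ennreal (norm (\<mu> (P j))) \<le> (\<Sum>i. ennreal (norm (\<mu> (P j \<inter> E i))))"
      by (rule norm_sums_le_suminf)
  qed auto
  also have "\<dots> = (\<Sum>i. \<Sum>j. ennreal (norm (\<mu> (P j \<inter> E i))))"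
    by (rule suminf_swap_ennreal)
  also have "\<dots> \<le> (\<Sum>i. total_variation \<mu> (E i))"
  proof (rule suminf_le)
    fix i
    show "(\<Sum>j. ennreal (norm (\<mu> (P j \<inter> E i)))) \<le> total_variation \<mu> (E i)"
      unfolding total_variation_def
    proof (rule SUP_upper)
      have "(\<Union>j. P j \<inter> E i) = E i"
        using P(3) by auto
      moreover have "disjoint_family (\<lambda>j. P j \<inter> E i)"
        using P(2) unfolding disjoint_family_on_def by blast
      ultimately show "(\<lambda>j. P j \<inter> E i) \<in>
          {P. range P \<subseteq> sets borel \<and> disjoint_family P \<and> (\<Union>j. P j) = E i}"
        using E P by auto
    qed
  qed auto
  finally show "(\<Sum>j. ennreal (norm (\<mu> (P j)))) \<le> (\<Sum>i. total_variation \<mu> (E i))" .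
qed

text \<open>Two partitions are merged by interleaving them along even and odd indices.\<close>

lemma total_variation_superadditive:
  assumes "A \<in> sets borel" "B \<in> sets borel" "A \<inter> B = {}"
  shows "total_variation \<mu> A + total_variation \<mu> B \<le> total_variation \<mu> (A \<union> B)"
proof -
  let ?\<P> = "\<lambda>A. {P::nat \<Rightarrow> real set. range P \<subseteq> sets borel \<and> disjoint_family P \<and> (\<Union>i. P i) = A}"
  let ?s = "\<lambda>P. \<Sum>i. ennreal (norm (\<mu> (P i)))"
  have le: "?s P + ?s Q \<le> total_variation \<mu> (A \<union> B)" if P: "P \<in> ?\<P> A" and Q: "Q \<in> ?\<P> B" for P Q
  proof -
    define R where "R k = (if even k then P (k div 2) else Q (k div 2))" for k
    have P': "\<And>i. P i \<in> sets borel" "\<And>i j. i \<noteq> j \<Longrightarrow> P i \<inter> P j = {}" "(\<Union>i. P i) = A"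
      using P by (auto simp: disjoint_family_on_def)
    have Q': "\<And>i. Q i \<in> sets borel" "\<And>i j. i \<noteq> j \<Longrightarrow> Q i \<inter> Q j = {}" "(\<Union>i. Q i) = B"
      using Q by (auto simp: disjoint_family_on_def)
    have "P i \<subseteq> A" "Q i \<subseteq> B" for i
      using P'(3) Q'(3) by auto
    then have PQ: "P i \<inter> Q j = {}" "Q j \<inter> P i = {}" for i j
      using assms(3) by blast+
    have UN: "(\<Union>k. R k) = A \<union> B"
    proof
      have "P i = R (2 * i)" "Q i = R (2 * i + 1)" for i
        by (simp_all add: R_def)
      then have "P i \<subseteq> (\<Union>k. R k)" "Q i \<subseteq> (\<Union>k. R k)" for i
        by (metis UN_upper UNIV_I)+
      then show "A \<union> B \<subseteq> (\<Union>k. R k)"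
        unfolding P'(3)[symmetric] Q'(3)[symmetric] by (intro Un_least UN_least)
      show "(\<Union>k. R k) \<subseteq> A \<union> B"
        using P'(3) Q'(3) unfolding R_def by (intro UN_least) auto
    qed
    have dis: "R m \<inter> R n = {}" if "m \<noteq> n" for m n
    proof -
      have "m div 2 \<noteq> n div 2" if "even m \<longleftrightarrow> even n"
        using that \<open>m \<noteq> n\<close> by (metis bit_eq_rec)
      then show ?thesis
        unfolding R_def using PQ P'(2) Q'(2) by simp
    qed
    have R: "R \<in> ?\<P> (A \<union> B)"
      using P'(1) Q'(1) UN dis by (auto simp: R_def disjoint_family_on_def)
    have "(\<lambda>n. (\<Sum>i<n. ennreal (norm (\<mu> (P i)))) + (\<Sum>i<n. ennreal (norm (\<mu> (Q i)))))
        \<longlonglongrightarrow> ?s P + ?s Q"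
      by (intro tendsto_add summable_LIMSEQ) auto
    moreover have "(\<Sum>i<n. ennreal (norm (\<mu> (P i)))) + (\<Sum>i<n. ennreal (norm (\<mu> (Q i)))) \<le> ?s R" for n
    proof -
      have "(\<Sum>i<n. ennreal (norm (\<mu> (P i)))) + (\<Sum>i<n. ennreal (norm (\<mu> (Q i))))
          = (\<Sum>k<2*n. ennreal (norm (\<mu> (R k))))"
        by (induction n) (simp_all add: R_def ac_simps)
      also have "\<dots> \<le> ?s R"
        by (rule sum_le_suminf) auto
      finally show ?thesis .
    qed
    ultimately have "?s P + ?s Q \<le> ?s R"
      by (intro LIMSEQ_le_const2) auto
    also have "\<dots> \<le> total_variation \<mu> (A \<union> B)"
      unfolding total_variation_def using R by (rule SUP_upper)
    finally show ?thesis .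
  qed
  \<comment> \<open>A summand can be moved into a supremum of extended nonnegative reals only over a
    nonempty index set.\<close>
  have ne: "?\<P> C \<noteq> {}" if "C \<in> sets borel" for C
    using borel_partition_of_pair[of C "{}"] that unfolding Un_empty_right by blast
  have "total_variation \<mu> A + total_variation \<mu> B = (SUP P\<in>?\<P> A. ?s P + total_variation \<mu> B)"
    unfolding total_variation_def[of \<mu> A] by (rule ennreal_SUP_add_left[symmetric]) (rule ne assms)+
  also have "\<dots> = (SUP P\<in>?\<P> A. SUP Q\<in>?\<P> B. ?s P + ?s Q)"
    unfolding total_variation_def[of \<mu> B]
  proof (rule SUP_cong[OF refl])
    fix P
    have "?s P + (SUP Q\<in>?\<P> B. ?s Q) = (SUP Q\<in>?\<P> B. ?s Q + ?s P)"
      unfolding ennreal_SUP_add_left[OF ne[OF assms(2)]] by (rule add.commute)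
    then show "?s P + (SUP Q\<in>?\<P> B. ?s Q) = (SUP Q\<in>?\<P> B. ?s P + ?s Q)"
      by (simp add: add.commute)
  qed
  also have "\<dots> \<le> total_variation \<mu> (A \<union> B)"
    by (intro SUP_least le)
  finally show ?thesis .
qed

lemma total_variation_mono:
  assumes "A \<in> sets borel" "B \<in> sets borel" "A \<subseteq> B"
  shows "total_variation \<mu> A \<le> total_variation \<mu> B"
proof -
  have "total_variation \<mu> A \<le> total_variation \<mu> A + total_variation \<mu> (B - A)"
    by simp
  also have "\<dots> \<le> total_variation \<mu> (A \<union> (B - A))"
    using assms by (intro total_variation_superadditive) auto
  also have "A \<union> (B - A) = B"
    using assms by auto
  finally show ?thesis .
qed

text \<open>Superadditivity and monotonicity bound every partial sum by the variation of the union;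
  the opposite inequality is countable subadditivity.\<close>

lemma total_variation_countably_additive:
  assumes \<mu>: "quat_measure \<mu>" and E: "\<And>i::nat. E i \<in> sets borel" "disjoint_family E"
  shows "(\<Sum>i. total_variation \<mu> (E i)) = total_variation \<mu> (\<Union>i. E i)"
proof (rule antisym)
  have sum_le: "(\<Sum>i<n. total_variation \<mu> (E i)) \<le> total_variation \<mu> (\<Union>i<n. E i)" for n
  proof (induction n)
    case 0
    show ?case
      by simp
  next
    case (Suc n)
    have "(\<Sum>i<Suc n. total_variation \<mu> (E i)) \<le> total_variation \<mu> (\<Union>i<n. E i) + total_variation \<mu> (E n)"
      using Suc by (simp add: add_right_mono)
    also have "\<dots> \<le> total_variation \<mu> ((\<Union>i<n. E i) \<union> E n)"
    proof (rule total_variation_superadditive)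
      show "(\<Union>i<n. E i) \<in> sets borel" "E n \<in> sets borel"
        using E(1) by simp_all
      have "E i \<inter> E n = {}" if "i < n" for i
        using disjoint_family_onD[OF E(2), of i n] that by simp
      then show "(\<Union>i<n. E i) \<inter> E n = {}"
        by blast
    qed
    also have "(\<Union>i<n. E i) \<union> E n = (\<Union>i<Suc n. E i)"
      by (simp add: lessThan_Suc Un_commute)
    finally show ?case .
  qed
  moreover have "total_variation \<mu> (\<Union>i<n. E i) \<le> total_variation \<mu> (\<Union>i. E i)" for n
  proof (rule total_variation_mono)
    show "(\<Union>i<n. E i) \<in> sets borel" "(\<Union>i. E i) \<in> sets borel"
      using E(1) by simp_all
  qed blast
  ultimately have "(\<Sum>i<n. total_variation \<mu> (E i)) \<le> total_variation \<mu> (\<Union>i. E i)" for n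
    by (rule order_trans)
  then show "(\<Sum>i. total_variation \<mu> (E i)) \<le> total_variation \<mu> (\<Union>i. E i)"
    by (rule suminf_le_const[rotated]) simp
qed (rule total_variation_countably_subadditive[OF assms])

section \<open>The variation measure and densities with respect to it\<close>

lemma sets_variation_measure [simp, measurable_cong]: "sets (variation_measure \<mu>) = sets borel"
  unfolding variation_measure_def using sets.sets_measure_of_eq[of borel] by simp

lemma space_variation_measure [simp]: "space (variation_measure \<mu>) = UNIV"
  unfolding variation_measure_def by simp

text \<open>\<open>measure_of\<close> yields the zero measure when its set function is not countably
  additive, so the preceding additivity is what makes \<open>variation_measure\<close>
  meaningful.\<close>

lemma emeasure_variation_measure:
  assumes \<mu>: "quat_measure \<mu>" and A: "A \<in> sets borel"
  shows "emeasure (variation_measure \<mu>) A = total_variation \<mu> A"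
  unfolding variation_measure_def
proof (rule emeasure_measure_of_sigma)
  show "sigma_algebra UNIV (sets (borel :: real measure))"
    by (metis sets.sigma_algebra_axioms space_borel)
  show "positive (sets borel) (total_variation \<mu>)"
    by (simp add: positive_def total_variation_empty \<mu>)
  show "countably_additive (sets borel) (total_variation \<mu>)"
  proof (rule countably_additiveI)
    fix E :: "nat \<Rightarrow> real set" assume "range E \<subseteq> sets borel" "disjoint_family E"
    then show "(\<Sum>i. total_variation \<mu> (E i)) = total_variation \<mu> (\<Union>i. E i)"
      by (intro total_variation_countably_additive[OF \<mu>]) (simp add: range_subsetD)
  qed
qed (rule A)

text \<open>For elements of \<open>S_measures\<close> finiteness follows from the exponential
  weight, which is at least 1; see \<open>finite_quat_measureI\<close>.\<close>

locale finite_quat_measure =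
  fixes \<mu> :: "real set \<Rightarrow> quat"
  assumes quat_measure: "quat_measure \<mu>"
    and total_variation_finite: "total_variation \<mu> UNIV < \<infinity>"
begin

sublocale variation: finite_measure "variation_measure \<mu>"
  using total_variation_finite by (intro finite_measureI)
    (simp add: emeasure_variation_measure quat_measure)

lemma norm_le_measure_variation:
  assumes "A \<in> sets borel"
  shows "norm (\<mu> A) \<le> measure (variation_measure \<mu>) A"
proof -
  have "ennreal (norm (\<mu> A)) \<le> ennreal (measure (variation_measure \<mu>) A)"
    using norm_le_total_variation[OF quat_measure assms]
    by (simp add: emeasure_variation_measure[OF quat_measure assms, symmetric] variation.emeasure_eq_measure)
  then show ?thesis
    by (simp add: measure_nonneg)
qed

end

text \<open>A signed measure dominated by a finite measure \<open>M\<close> becomes positive after adding \<open>M\<close>, so that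
  the Radon-Nikodym theorem for positive measures applies.\<close>

lemma Radon_Nikodym_signed:
  fixes \<nu> :: "'a set \<Rightarrow> real"
  assumes "finite_measure M"
    and sums: "\<And>A::nat \<Rightarrow> 'a set. range A \<subseteq> sets M \<Longrightarrow> disjoint_family A \<Longrightarrow> (\<lambda>i. \<nu> (A i)) sums \<nu> (\<Union>i. A i)"
    and le: "\<And>A. A \<in> sets M \<Longrightarrow> \<bar>\<nu> A\<bar> \<le> measure M A"
  obtains g where "integrable M g" "\<And>A. A \<in> sets M \<Longrightarrow> \<nu> A = (LINT x:A|M. g x)"
proof -
  interpret finite_measure M by fact
  define N where "N = measure_of (space M) (sets M) (\<lambda>A. ennreal (measure M A + \<nu> A))"
  have nonneg: "0 \<le> measure M A + \<nu> A" if "A \<in> sets M" for A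
    using le[OF that] by linarith
  have sets_N [simp]: "sets N = sets M" and space_N [simp]: "space N = space M"
    unfolding N_def using sets.sets_measure_of_eq[of M] sets.space_closed[of M] by auto
  have N: "emeasure N A = ennreal (measure M A + \<nu> A)" if "A \<in> sets M" for A
    unfolding N_def
  proof (rule emeasure_measure_of_sigma)
    show "sigma_algebra (space M) (sets M)" ..
    have "\<nu> {} = 0"
      using le[of "{}"] by simp
    then show "positive (sets M) (\<lambda>A. ennreal (measure M A + \<nu> A))"
      by (simp add: positive_def)
    show "countably_additive (sets M) (\<lambda>A. ennreal (measure M A + \<nu> A))"
    proof (rule countably_additiveI)
      fix A :: "nat \<Rightarrow> 'a set" assume A: "range A \<subseteq> sets M" "disjoint_family A"
      have "(\<lambda>i. measure M (A i) + \<nu> (A i)) sums (measure M (\<Union>i. A i) + \<nu> (\<Union>i. A i))"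
        using A by (intro sums_add sums finite_measure_UNION)
      moreover have "0 \<le> measure M (A i) + \<nu> (A i)" for i
        using A by (intro nonneg) auto
      ultimately show "(\<Sum>i. ennreal (measure M (A i) + \<nu> (A i))) = ennreal (measure M (\<Union>i. A i) + \<nu> (\<Union>i. A i))"
        by (intro suminf_ennreal_eq)
    qed
  qed (rule that)
  \<comment> \<open>The domination of \<open>\<nu>\<close> by \<open>M\<close> is used a second
    time: a null set of \<open>M\<close> has \<open>\<nu>\<close>-value 0.\<close>
  have "absolutely_continuous M N"
    unfolding absolutely_continuous_def
  proof
    fix A assume A: "A \<in> null_sets M"
    then have "A \<in> sets M" "measure M A = 0"
      by (auto simp: null_sets_def measure_def)
    then show "A \<in> null_sets N"
      using le[of A] by (auto simp: null_sets_def N)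
  qed
  from Radon_Nikodym[OF this sets_N] obtain k where k[measurable]: "k \<in> borel_measurable M"
    and density: "density M k = N"
    by blast
  have kN: "(\<integral>\<^sup>+x. k x * indicator A x \<partial>M) = ennreal (measure M A + \<nu> A)" if "A \<in> sets M" for A
    using N[OF that] density emeasure_density[OF k that] by simp
  have "(\<integral>\<^sup>+x. k x \<partial>M) = (\<integral>\<^sup>+x. k x * indicator (space M) x \<partial>M)"
    by (intro nn_integral_cong) auto
  then have fin: "(\<integral>\<^sup>+x. k x \<partial>M) < \<infinity>"
    using kN[of "space M"] by (simp del: mult_indicator_subset)
  have AE: "AE x in M. k x \<noteq> \<infinity>"
    using fin by (intro nn_integral_PInf_AE) auto
  \<comment> \<open>Subtracting 1, the density of \<open>M\<close> itself, undoes the shift from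
    \<open>\<nu>\<close> to \<open>M + \<nu>\<close>. The value 0 of \<open>enn2real\<close> at
    infinity matters only on a null set.\<close>
  define g where "g x = enn2real (k x) - 1" for x
  have eint: "integrable M (\<lambda>x. enn2real (k x))"
  proof (rule integrableI_nonneg)
    have "(\<integral>\<^sup>+x. ennreal (enn2real (k x)) \<partial>M) \<le> (\<integral>\<^sup>+x. k x \<partial>M)"
      by (intro nn_integral_mono) (simp add: ennreal_enn2real_if)
    then show "(\<integral>\<^sup>+x. ennreal (enn2real (k x)) \<partial>M) < \<infinity>"
      using fin by (rule le_less_trans)
  qed auto
  show ?thesis
  proof
    show "integrable M g"
      unfolding g_def using eint by simp
    fix A assume A[measurable]: "A \<in> sets M"
    have "(LINT x:A|M. enn2real (k x)) = measure M A + \<nu> A"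
    proof -
      have "(LINT x:A|M. enn2real (k x)) = enn2real (\<integral>\<^sup>+x. ennreal (indicator A x *\<^sub>R enn2real (k x)) \<partial>M)"
        unfolding set_lebesgue_integral_def by (intro integral_eq_nn_integral) auto
      also have "(\<integral>\<^sup>+x. ennreal (indicator A x *\<^sub>R enn2real (k x)) \<partial>M) = (\<integral>\<^sup>+x. k x * indicator A x \<partial>M)"
        using AE by (intro nn_integral_cong_AE, eventually_elim) (auto simp: indicator_def ennreal_enn2real_if)
      also have "enn2real \<dots> = measure M A + \<nu> A"
        using kN[OF A] nonneg[OF A] by simp
      finally show ?thesis .
    qed
    moreover have "(LINT x:A|M. g x) = (LINT x:A|M. enn2real (k x)) - (LINT x:A|M. 1)"
      unfolding g_def
    proof (rule set_integral_diff(2))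
      show "set_integrable M A (\<lambda>x. enn2real (k x))" "set_integrable M A (\<lambda>x. 1 :: real)"
        unfolding set_integrable_def by (rule integrable_mult_indicator[OF A], simp add: eint)+
    qed
    moreover have "(LINT x:A|M. (1::real)) = measure M A"
      by (simp add: set_lebesgue_integral_def)
    ultimately show "\<nu> A = (LINT x:A|M. g x)"
      by simp
  qed
qed

text \<open>Each coordinate inherits the domination by \<open>M\<close> and has a real density;
  these are reassembled along the basis.\<close>

lemma Radon_Nikodym_euclidean:
  fixes \<nu> :: "'a set \<Rightarrow> 'b::euclidean_space"
  assumes "finite_measure M"
    and sums: "\<And>A::nat \<Rightarrow> 'a set. range A \<subseteq> sets M \<Longrightarrow> disjoint_family A \<Longrightarrow> (\<lambda>i. \<nu> (A i)) sums \<nu> (\<Union>i. A i)"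
    and le: "\<And>A. A \<in> sets M \<Longrightarrow> norm (\<nu> A) \<le> measure M A"
  obtains h where "integrable M h" "\<And>A. A \<in> sets M \<Longrightarrow> \<nu> A = (LINT x:A|M. h x)"
proof -
  have "\<forall>b\<in>Basis. \<exists>g. integrable M g \<and> (\<forall>A\<in>sets M. \<nu> A \<bullet> b = (LINT x:A|M. g x))"
  proof
    fix b :: 'b assume "b \<in> Basis"
    then have "\<bar>\<nu> A \<bullet> b\<bar> \<le> measure M A" if "A \<in> sets M" for A
      using le[OF that] Basis_le_norm[of b "\<nu> A"] by linarith
    moreover have "(\<lambda>i. \<nu> (A i) \<bullet> b) sums (\<nu> (\<Union>i. A i) \<bullet> b)"
      if "range A \<subseteq> sets M" "disjoint_family A" for A :: "nat \<Rightarrow> 'a set"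
      using bounded_linear.sums[OF bounded_linear_inner_left sums[OF that]] .
    ultimately show "\<exists>g. integrable M g \<and> (\<forall>A\<in>sets M. \<nu> A \<bullet> b = (LINT x:A|M. g x))"
      using Radon_Nikodym_signed[OF assms(1), of "\<lambda>A. \<nu> A \<bullet> b"] by metis
  qed
  then obtain g where g: "\<And>b. b \<in> Basis \<Longrightarrow> integrable M (g b)"
      "\<And>b A. b \<in> Basis \<Longrightarrow> A \<in> sets M \<Longrightarrow> \<nu> A \<bullet> b = (LINT x:A|M. g b x)"
    by (metis (no_types, lifting) bchoice)
  show ?thesis
  proof
    show "integrable M (\<lambda>x. \<Sum>b\<in>Basis. g b x *\<^sub>R b)"
      using g by auto
    fix A assume A[measurable]: "A \<in> sets M"
    have i: "integrable M (\<lambda>x. indicator A x *\<^sub>R g b x)" if "b \<in> Basis" for b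
      using g(1)[OF that] by (intro integrable_mult_indicator A)
    have "\<nu> A = (\<Sum>b\<in>Basis. (\<nu> A \<bullet> b) *\<^sub>R b)"
      by (simp add: euclidean_representation)
    also have "\<dots> = (\<Sum>b\<in>Basis. (LINT x|M. (indicator A x *\<^sub>R g b x) *\<^sub>R b))"
      using g(2)[OF _ A] i by (intro sum.cong refl) (simp add: set_lebesgue_integral_def)
    also have "\<dots> = (LINT x|M. (\<Sum>b\<in>Basis. (indicator A x *\<^sub>R g b x) *\<^sub>R b))"
      using i by (subst Bochner_Integration.integral_sum) auto
    also have "\<dots> = (LINT x:A|M. (\<Sum>b\<in>Basis. g b x *\<^sub>R b))"
      by (simp add: set_lebesgue_integral_def scaleR_sum_right)
    finally show "\<nu> A = (LINT x:A|M. (\<Sum>b\<in>Basis. g b x *\<^sub>R b))" .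
  qed
qed

text \<open>The integral triangle inequality on each piece of a partition, summed up. With the
  converse below, the variation of a measure with density \<open>h\<close> has density
  \<open>norm h\<close>.\<close>

lemma total_variation_le_density:
  assumes M: "sets M = sets borel" and h: "integrable M h"
    and \<mu>: "\<And>A. A \<in> sets borel \<Longrightarrow> \<mu> A = (LINT x:A|M. h x)"
    and A: "A \<in> sets borel"
  shows "total_variation \<mu> A \<le> (\<integral>\<^sup>+x\<in>A. norm (h x) \<partial>M)"
  unfolding total_variation_def
proof (rule SUP_least)
  note M[measurable_cong]
  have [measurable]: "h \<in> borel_measurable M"
    using h by simp
  fix P :: "nat \<Rightarrow> real set"
  assume "P \<in> {P. range P \<subseteq> sets borel \<and> disjoint_family P \<and> (\<Union>i. P i) = A}"
  then have P[measurable]: "\<And>i. P i \<in> sets borel" and P': "disjoint_family P" "(\<Union>i. P i) = A"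
    by auto
  have "(\<Sum>i. ennreal (norm (\<mu> (P i)))) \<le> (\<Sum>i. \<integral>\<^sup>+x\<in>P i. norm (h x) \<partial>M)"
  proof (rule suminf_le)
    fix i
    have "ennreal (norm (\<mu> (P i))) \<le> (\<integral>\<^sup>+x. norm (indicator (P i) x *\<^sub>R h x) \<partial>M)"
      unfolding \<mu>[OF P] set_lebesgue_integral_def
      using h by (intro integral_norm_bound_ennreal integrable_mult_indicator) (auto simp: M)
    also have "\<dots> = (\<integral>\<^sup>+x\<in>P i. norm (h x) \<partial>M)"
      by (intro nn_integral_cong) (auto simp: indicator_def)
    finally show "ennreal (norm (\<mu> (P i))) \<le> (\<integral>\<^sup>+x\<in>P i. norm (h x) \<partial>M)" .
  qed auto
  also have "\<dots> = (\<Sum>i. emeasure (density M (\<lambda>x. norm (h x))) (P i))"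
    by (simp add: emeasure_density M)
  also have "\<dots> = emeasure (density M (\<lambda>x. norm (h x))) A"
    using P P' by (subst suminf_emeasure) (auto simp: M)
  also have "\<dots> = (\<integral>\<^sup>+x\<in>A. norm (h x) \<partial>M)"
    using A by (simp add: emeasure_density M)
  finally show "(\<Sum>i. ennreal (norm (\<mu> (P i)))) \<le> (\<integral>\<^sup>+x\<in>A. norm (h x) \<partial>M)" .
qed

text \<open>\<open>A\<close> is cut into countably many pieces on which \<open>h\<close> stays
  within \<open>e\<close> of a constant. There the norm of the integral almost equals the integral
  of the norm, so this one partition nearly attains the supremum; since \<open>M\<close> is finite
  the total error vanishes with \<open>e\<close>.\<close>

lemma density_le_total_variation:
  fixes h :: "real \<Rightarrow> quat"
  assumes "finite_measure M" and M: "sets M = sets borel" and h: "integrable M h"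
    and \<mu>: "\<And>A. A \<in> sets borel \<Longrightarrow> \<mu> A = (LINT x:A|M. h x)"
    and A: "A \<in> sets borel"
  shows "(\<integral>\<^sup>+x\<in>A. norm (h x) \<partial>M) \<le> total_variation \<mu> A"
proof -
  interpret finite_measure M by fact
  note M[measurable_cong] and A[measurable]
  have [measurable]: "h \<in> borel_measurable M"
    using h by simp
  obtain Q :: "quat set" where Q: "countable Q" "\<And>X. open X \<Longrightarrow> X \<noteq> {} \<Longrightarrow> \<exists>d\<in>Q. d \<in> X"
    using countable_dense_exists by blast
  have "Q \<noteq> {}"
    using Q(2)[of UNIV] by auto
  define q where "q = from_nat_into Q"
  have q: "\<exists>i. dist y (q i) < e" if "e > 0" for y e
  proof -
    have "\<exists>d\<in>Q. d \<in> ball y e"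
      by (rule Q(2)) (use that in auto)
    then obtain d where "d \<in> Q" "d \<in> ball y e" ..
    moreover obtain i where "d = q i"
      using from_nat_into_surj[OF Q(1) \<open>d \<in> Q\<close>] unfolding q_def by blast
    ultimately show ?thesis
      by auto
  qed
  \<comment> \<open>The error is 2 e per unit of mass: once for replacing \<open>h\<close> by
    \<open>q i\<close> in the value of \<open>\<mu>\<close>, once for bounding
    \<open>norm (h x)\<close> by \<open>norm (q i) + e\<close>.\<close>
  have approx: "(\<integral>\<^sup>+x\<in>A. norm (h x) \<partial>M) \<le> total_variation \<mu> A + ennreal (2 * e * measure M A)"
    if e: "e > 0" for e
  proof -
    \<comment> \<open>Balls around a countable dense set cover the quaternions; making them disjoint
      turns their preimages into a partition.\<close>
    define B where "B = disjointed (\<lambda>i. ball (q i) e)"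
    have "range (\<lambda>i. ball (q i) e) \<subseteq> sets borel"
      by auto
    from sets.range_disjointed_sets[OF this] have B[measurable]: "B i \<in> sets borel" for i
      unfolding B_def by auto
    have B_ball: "norm (y - q i) < e" if "y \<in> B i" for y i
      using disjointed_subset[of "\<lambda>i. ball (q i) e" i] that
      by (auto simp: B_def dist_norm norm_minus_commute)
    have "(\<Union>i. B i) = UNIV"
      unfolding B_def UN_disjointed_eq using q[OF e] by (auto simp: dist_commute)
    have "disjoint_family B"
      unfolding B_def by (rule disjoint_family_disjointed)
    have spM: "space M = UNIV"
      using M sets_eq_imp_space_eq by force
    define P where "P i = A \<inter> h -` B i" for i
    have P[measurable]: "P i \<in> sets borel" for i
      using measurable_sets[OF \<open>h \<in> borel_measurable M\<close> B[of i]] A by (auto simp: P_def M spM)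
    have P_disj: "disjoint_family P"
      using \<open>disjoint_family B\<close> unfolding P_def disjoint_family_on_def by blast
    have P_UN: "(\<Union>i. P i) = A"
      using \<open>(\<Union>i. B i) = UNIV\<close> unfolding P_def by blast
    have "(\<integral>\<^sup>+x\<in>A. norm (h x) \<partial>M) = emeasure (density M (\<lambda>x. norm (h x))) A"
      by (simp add: emeasure_density)
    also have "\<dots> = (\<Sum>i. emeasure (density M (\<lambda>x. norm (h x))) (P i))"
      using P P_disj P_UN by (subst suminf_emeasure) (auto simp: M)
    also have "\<dots> \<le> (\<Sum>i. ennreal (norm (\<mu> (P i))) + ennreal (2 * e) * emeasure M (P i))"
    proof (rule suminf_le)
      fix i
      have int: "integrable M (\<lambda>x. indicator (P i) x *\<^sub>R h x)"
          "integrable M (\<lambda>x. indicator (P i) x *\<^sub>R q i)" 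
          "integrable M (\<lambda>x. indicator (P i) x *\<^sub>R (h x - q i))"
        using h by (auto intro!: integrable_mult_indicator)
      have "norm ((LINT x:P i|M. h x) - measure M (P i) *\<^sub>R q i)
          = norm (LINT x|M. indicator (P i) x *\<^sub>R (h x - q i))"
        unfolding set_lebesgue_integral_def using int
          has_bochner_integral_integral_eq[OF has_bochner_integral_indicator[of "P i" M "q i"]]
        by (simp add: scaleR_diff_right M emeasure_finite less_top[symmetric])
      also have "\<dots> \<le> (LINT x|M. norm (indicator (P i) x *\<^sub>R (h x - q i)))"
        by (rule integral_norm_bound)
      also have "\<dots> \<le> (LINT x|M. indicator (P i) x * e)"
      proof (rule integral_mono)
        show "integrable M (\<lambda>x. norm (indicator (P i) x *\<^sub>R (h x - q i)))"
          using int(3) by (rule integrable_norm)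
        show "integrable M (\<lambda>x. indicator (P i) x * e)"
          by (intro integrable_mult_left integrable_real_indicator) (auto simp: M emeasure_finite less_top[symmetric])
        show "norm (indicator (P i) x *\<^sub>R (h x - q i)) \<le> indicator (P i) x * e" for x
          using B_ball[of "h x" i] by (auto simp: indicator_def P_def)
      qed
      also have "\<dots> = e * measure M (P i)"
        by simp
      finally have 1: "norm (\<mu> (P i) - measure M (P i) *\<^sub>R q i) \<le> e * measure M (P i)"
        by (simp add: \<mu>)
      have "(\<integral>\<^sup>+x\<in>P i. norm (h x) \<partial>M) \<le> (\<integral>\<^sup>+x\<in>P i. (norm (q i) + e) \<partial>M)"
      proof (rule nn_integral_mono)
        fix x
        have "norm (h x) \<le> norm (q i) + e" if "x \<in> P i"
          using B_ball[of "h x" i] norm_triangle_sub[of "h x" "q i"] that by (simp add: P_def)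
        then show "ennreal (norm (h x)) * indicator (P i) x \<le> ennreal (norm (q i) + e) * indicator (P i) x"
          by (auto simp: indicator_def intro: ennreal_leI)
      qed
      also have "\<dots> = ennreal ((norm (q i) + e) * measure M (P i))"
        using e by (simp add: emeasure_eq_measure nn_integral_cmult_indicator ennreal_mult)
      also have "\<dots> \<le> ennreal (norm (\<mu> (P i)) + 2 * e * measure M (P i))"
      proof (rule ennreal_leI)
        have "measure M (P i) * norm (q i) \<le> norm (\<mu> (P i)) + norm (\<mu> (P i) - measure M (P i) *\<^sub>R q i)"
          using norm_triangle_sub[of "measure M (P i) *\<^sub>R q i" "\<mu> (P i)"]
          by (simp add: norm_minus_commute)
        with 1 show "(norm (q i) + e) * measure M (P i) \<le> norm (\<mu> (P i)) + 2 * e * measure M (P i)"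
          by (simp add: algebra_simps)
      qed
      also have "\<dots> = ennreal (norm (\<mu> (P i))) + ennreal (2 * e) * emeasure M (P i)"
        using e by (simp add: emeasure_eq_measure ennreal_mult)
      finally show "emeasure (density M (\<lambda>x. norm (h x))) (P i)
          \<le> ennreal (norm (\<mu> (P i))) + ennreal (2 * e) * emeasure M (P i)"
        by (simp add: emeasure_density)
    qed auto
    also have "\<dots> = (\<Sum>i. ennreal (norm (\<mu> (P i)))) + ennreal (2 * e) * (\<Sum>i. emeasure M (P i))"
      by (simp add: suminf_add[symmetric])
    also have "(\<Sum>i. emeasure M (P i)) = emeasure M A"
      using P P_disj P_UN by (subst suminf_emeasure) (auto simp: M)
    also have "(\<Sum>i. ennreal (norm (\<mu> (P i)))) \<le> total_variation \<mu> A"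
      unfolding total_variation_def using P P_disj P_UN by (intro SUP_upper) auto
    finally show ?thesis
      using e by (simp add: emeasure_eq_measure ennreal_mult)
  qed
  show ?thesis
  proof (rule tendsto_lowerbound[OF _ _ trivial_limit_at_right_real])
    have "((\<lambda>e. total_variation \<mu> A + ennreal (2 * e * measure M A)) \<longlongrightarrow>
        total_variation \<mu> A + ennreal (2 * 0 * measure M A)) (at_right 0)"
      by (intro tendsto_intros)
    then show "((\<lambda>e. total_variation \<mu> A + ennreal (2 * e * measure M A)) \<longlongrightarrow>
        total_variation \<mu> A) (at_right 0)"
      by simp
    show "\<forall>\<^sub>F e in at_right 0. (\<integral>\<^sup>+x\<in>A. norm (h x) \<partial>M) \<le> total_variation \<mu> A + ennreal (2 * e * measure M A)"
      using approx by (auto simp: eventually_at_filter)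
  qed
qed

context finite_quat_measure
begin

text \<open>Existence of the object that \<open>polar_density\<close> chooses. Radon-Nikodym with
  the variation as dominating measure gives a density \<open>h\<close>; the two estimates above give
  the variation the density \<open>norm h\<close> with respect to itself, so \<open>norm h\<close>
  is 1 almost everywhere.\<close>

lemma polar_density:
  "polar_density \<mu> \<in> borel_measurable borel"
  "norm (polar_density \<mu> t) = 1"
  "A \<in> sets borel \<Longrightarrow> \<mu> A = (LINT t:A|variation_measure \<mu>. polar_density \<mu> t)"
proof -
  let ?M = "variation_measure \<mu>"
  obtain h where h: "integrable ?M h" "\<And>A. A \<in> sets borel \<Longrightarrow> \<mu> A = (LINT t:A|?M. h t)"
  proof (rule Radon_Nikodym_euclidean[of ?M \<mu>])
    show "(\<lambda>i. \<mu> (A i)) sums \<mu> (\<Union>i. A i)" if "range A \<subseteq> sets ?M" "disjoint_family A" for A :: "nat \<Rightarrow> real set"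
      using that by (intro quat_measure_sums quat_measure) auto
  qed (auto intro: norm_le_measure_variation variation.finite_measure_axioms)
  have [measurable]: "h \<in> borel_measurable borel"
    using h(1) borel_measurable_integrable[of ?M h] by simp
  have "total_variation \<mu> A = (\<integral>\<^sup>+t\<in>A. norm (h t) \<partial>?M)" if "A \<in> sets borel" for A
    using total_variation_le_density[OF _ h that]
      density_le_total_variation[OF variation.finite_measure_axioms _ h that] by (intro antisym) auto
  then have "density ?M (\<lambda>t. ennreal (norm (h t))) = density ?M (\<lambda>t. 1)"
    by (intro measure_eqI) (auto simp: emeasure_density emeasure_variation_measure quat_measure)
  then have "AE t in ?M. ennreal (norm (h t)) = 1"
    by (intro variation.density_unique) auto
  then have AE: "AE t in ?M. norm (h t) = 1"
    by simp
  \<comment> \<open>The chosen density has modulus 1 at every point, so the exceptional null set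
    receives the value 1.\<close>
  define k where "k t = (if norm (h t) = 1 then h t else 1)" for t
  have [measurable]: "k \<in> borel_measurable borel"
    unfolding k_def by measurable
  have "(LINT t:A|?M. h t) = (LINT t:A|?M. k t)" if "A \<in> sets borel" for A
    unfolding set_lebesgue_integral_def using that AE
    by (intro integral_cong_AE) (auto simp: k_def)
  then have "\<exists>k. k \<in> borel_measurable borel \<and> (\<forall>t. norm (k t) = 1) \<and> (\<forall>A\<in>sets borel. \<mu> A = (LINT t:A|?M. k t))"
    using h(2) by (intro exI[of _ k]) (auto simp: k_def)
  from someI_ex[OF this] show "polar_density \<mu> \<in> borel_measurable borel"
    "norm (polar_density \<mu> t) = 1"
    "A \<in> sets borel \<Longrightarrow> \<mu> A = (LINT t:A|?M. polar_density \<mu> t)"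
    unfolding polar_density_def by blast+
qed

end

section \<open>Riemann sums\<close>

text \<open>Rounding towards zero makes every function that is increasing in \<open>\<bar>t\<bar>\<close> decrease, so that the
  exponential weight of a measure dominates its Riemann sums.\<close>

definition grid :: "nat \<Rightarrow> real \<Rightarrow> real"
  where "grid n t = (if \<bar>t\<bar> \<le> real n then sgn t * of_int \<lfloor>real (Suc n) * \<bar>t\<bar>\<rfloor> / real (Suc n) else 0)"

lemma floor_div_le:
  fixes x :: real
  assumes "x \<ge> 0"
  shows "0 \<le> of_int \<lfloor>real (Suc n) * x\<rfloor> / real (Suc n)" "of_int \<lfloor>real (Suc n) * x\<rfloor> / real (Suc n) \<le> x"
    "x - of_int \<lfloor>real (Suc n) * x\<rfloor> / real (Suc n) \<le> 1 / real (Suc n)"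
proof -
  let ?N = "real (Suc n)"
  have N: "?N > 0" by simp
  have "0 \<le> \<lfloor>?N * x\<rfloor>"
    using assms by simp
  then show "0 \<le> of_int \<lfloor>?N * x\<rfloor> / ?N"
    by simp
  have "of_int \<lfloor>?N * x\<rfloor> / ?N \<le> ?N * x / ?N"
    by (intro divide_right_mono) auto
  then show "of_int \<lfloor>?N * x\<rfloor> / ?N \<le> x"
    using N by simp
  have "?N * x - 1 \<le> of_int \<lfloor>?N * x\<rfloor>"
    by linarith
  then have "(?N * x - 1) / ?N \<le> of_int \<lfloor>?N * x\<rfloor> / ?N"
    by (rule divide_right_mono) simp
  then show "x - of_int \<lfloor>?N * x\<rfloor> / ?N \<le> 1 / ?N"
    using N by (simp add: diff_divide_distrib)
qed

lemma abs_grid_le: "\<bar>grid n t\<bar> \<le> \<bar>t\<bar>"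
proof (cases "\<bar>t\<bar> \<le> real n")
  case True
  then have "\<bar>grid n t\<bar> = \<bar>sgn t\<bar> * (of_int \<lfloor>real (Suc n) * \<bar>t\<bar>\<rfloor> / real (Suc n))"
    using floor_div_le(1)[of "\<bar>t\<bar>" n] by (simp add: grid_def abs_mult)
  also have "\<dots> \<le> 1 * \<bar>t\<bar>"
    using floor_div_le(1,2)[of "\<bar>t\<bar>" n] by (intro mult_mono) (auto simp: sgn_if)
  finally show ?thesis
    by simp
qed (simp add: grid_def)

lemma grid_tendsto: "(\<lambda>n. grid n t) \<longlonglongrightarrow> t"
proof -
  have "(\<lambda>n. grid n t - t) \<longlonglongrightarrow> 0"
  proof (rule Lim_null_comparison)
    show "(\<lambda>n. 1 / real (Suc n)) \<longlonglongrightarrow> 0"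
      using LIMSEQ_inverse_real_of_nat by (simp add: inverse_eq_divide)
    have "norm (grid n t - t) \<le> 1 / real (Suc n)" if "\<bar>t\<bar> \<le> real n" for n
    proof -
      have "norm (grid n t - t) = \<bar>sgn t * (of_int \<lfloor>real (Suc n) * \<bar>t\<bar>\<rfloor> / real (Suc n) - \<bar>t\<bar>)\<bar>"
        using that by (simp add: grid_def right_diff_distrib sgn_mult_abs)
      also have "\<dots> = \<bar>sgn t\<bar> * \<bar>of_int \<lfloor>real (Suc n) * \<bar>t\<bar>\<rfloor> / real (Suc n) - \<bar>t\<bar>\<bar>"
        by (rule abs_mult)
      also have "\<dots> \<le> 1 * (1 / real (Suc n))"
        using floor_div_le(2,3)[of "\<bar>t\<bar>" n] by (intro mult_mono) (auto simp: sgn_if)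
      finally show ?thesis
        by simp
    qed
    \<comment> \<open>From the rounded-up modulus of \<open>t\<close> onwards the point lies inside
      the cutoff.\<close>
    then show "\<forall>\<^sub>F n in sequentially. norm (grid n t - t) \<le> 1 / real (Suc n)"
      by (rule eventually_mono[OF eventually_ge_at_top[of "nat \<lceil>\<bar>t\<bar>\<rceil>"]]) linarith
  qed
  then show ?thesis
    by (simp add: LIM_zero_iff)
qed

lemma borel_measurable_grid [measurable]: "grid n \<in> borel_measurable borel"
  unfolding grid_def by measurable

lemma grid_sets: "grid n -` {y} \<in> sets borel"
  using measurable_sets[OF borel_measurable_grid, of "{y}" n] by simp

lemma finite_range_grid: "finite (range (grid n))"
proof (rule finite_subset)
  show "range (grid n) \<subseteq>
      insert 0 ((\<lambda>(\<sigma>, k). \<sigma> * of_int k / real (Suc n)) ` ({- 1, 0, 1} \<times> {0..\<lfloor>real (Suc n) * real n\<rfloor>}))"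
  proof (rule image_subsetI)
    fix t
    show "grid n t \<in> insert 0 ((\<lambda>(\<sigma>, k). \<sigma> * of_int k / real (Suc n)) `
        ({- 1, 0, 1} \<times> {0..\<lfloor>real (Suc n) * real n\<rfloor>}))"
    proof (cases "\<bar>t\<bar> \<le> real n")
      case True
      then have "\<lfloor>real (Suc n) * \<bar>t\<bar>\<rfloor> \<le> \<lfloor>real (Suc n) * real n\<rfloor>"
        by (intro floor_mono mult_left_mono) auto
      then have "(sgn t, \<lfloor>real (Suc n) * \<bar>t\<bar>\<rfloor>) \<in> {- 1, 0, 1} \<times> {0..\<lfloor>real (Suc n) * real n\<rfloor>}"
        by (auto simp: sgn_if)
      moreover have "grid n t = (\<lambda>(\<sigma>, k). \<sigma> * of_int k / real (Suc n)) (sgn t, \<lfloor>real (Suc n) * \<bar>t\<bar>\<rfloor>)"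
        using True by (simp add: grid_def)
      ultimately show ?thesis
        by (intro insertI2 image_eqI)
    qed (simp add: grid_def)
  qed
qed auto

lemma simple_function_grid:
  assumes "sets M = sets borel"
  shows "simple_function M (grid n)"
proof (rule simple_function_borel_measurable)
  show "grid n \<in> borel_measurable M"
    using measurable_cong_sets[OF assms refl] borel_measurable_grid by blast
  show "finite (grid n ` space M)"
    using finite_range_grid by (rule rev_finite_subset) auto
qed

definition riemann_sum :: "nat \<Rightarrow> (real set \<Rightarrow> quat) \<Rightarrow> (real \<Rightarrow> 'v::two_sided_quat_banach) \<Rightarrow> 'v"
  where "riemann_sum n \<mu> F = (\<Sum>y\<in>range (grid n). \<mu> (grid n -` {y}) *\<^sub>l F y)"

section \<open>Exponential weights and convergence of Riemann sums\<close>

lemma exp_integrable_mono: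
  assumes "exp_integrable r \<mu>" "r' \<le> r"
  shows "exp_integrable r' \<mu>"
proof -
  have "(\<integral>\<^sup>+t. ennreal (exp (r' * \<bar>t\<bar>)) \<partial>variation_measure \<mu>)
      \<le> (\<integral>\<^sup>+t. ennreal (exp (r * \<bar>t\<bar>)) \<partial>variation_measure \<mu>)"
    using assms(2) by (intro nn_integral_mono ennreal_leI) (simp add: mult_right_mono)
  then show ?thesis
    using assms(1) unfolding exp_integrable_def by (rule le_less_trans)
qed

lemma finite_quat_measureI:
  assumes "quat_measure \<mu>" "exp_integrable r \<mu>" "r \<ge> 0"
  shows "finite_quat_measure \<mu>"
proof
  have "exp_integrable 0 \<mu>"
    using exp_integrable_mono assms(2,3) by blast
  then show "total_variation \<mu> UNIV < \<infinity>"
    by (simp add: exp_integrable_def emeasure_variation_measure[OF assms(1)])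
qed (rule assms)

lemma integrable_exp_weight:
  assumes "exp_integrable r \<mu>"
  shows "integrable (variation_measure \<mu>) (\<lambda>t. exp (r * \<bar>t\<bar>))"
  using assms unfolding exp_integrable_def by (intro integrableI_nonneg) auto

lemma exp_weight_mono:
  fixes s t r :: real
  assumes "\<bar>s\<bar> \<le> \<bar>t\<bar>" "r \<ge> 0"
  shows "exp (r * \<bar>s\<bar>) \<le> exp (r * \<bar>t\<bar>)"
  using assms by (simp add: mult_left_mono)

lemma exp_weight_sum_le:
  fixes r :: real
  assumes "r \<ge> 0"
  shows "exp (r * \<bar>s + t\<bar>) \<le> exp (r * \<bar>s\<bar>) * exp (r * \<bar>t\<bar>)"
  using mult_left_mono[OF abs_triangle_ineq assms, of s t]
  by (simp add: exp_add[symmetric] distrib_left)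

text \<open>The case of \<open>has_bochner_fibre_limit\<close> in which \<open>h\<close> is the
  polar density, whose fibre integrals are values of \<open>\<mu>\<close>. The exponential weight at
  \<open>t\<close> dominates the sample at \<open>grid n t\<close> because rounding never increases
  the modulus.\<close>

lemma (in finite_quat_measure) riemann_sum_tendsto:
  fixes F :: "real \<Rightarrow> 'v::two_sided_quat_banach"
  assumes F: "continuous_on UNIV F" and bound: "\<And>t. norm (F t) \<le> C * exp (r * \<bar>t\<bar>)"
    and r: "r \<ge> 0" "exp_integrable r \<mu>"
  shows "(\<lambda>n. riemann_sum n \<mu> F) \<longlonglongrightarrow> quat_measure_integral \<mu> F"
proof -
  have "0 \<le> C"
    using order_trans[OF norm_ge_zero bound[of 0]] by simp
  obtain x where x: "has_bochner (variation_measure \<mu>) (\<lambda>t. polar_density \<mu> t *\<^sub>l F t) x"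
    "(\<lambda>n. \<Sum>y\<in>grid n ` space (variation_measure \<mu>).
      (LINT t:grid n -` {y} \<inter> space (variation_measure \<mu>)|variation_measure \<mu>. polar_density \<mu> t) *\<^sub>l F y) \<longlonglongrightarrow> x"
  proof (rule has_bochner_fibre_limit[where h="polar_density \<mu>" and F=F and D=grid and f=F and M="variation_measure \<mu>"])
    show "integrable (variation_measure \<mu>) (\<lambda>t. C * exp (r * \<bar>t\<bar>))"
      using integrable_exp_weight[OF r(2)] by simp
    show "norm (F (grid n t)) \<le> C * exp (r * \<bar>t\<bar>)" for n t
      using bound[of "grid n t"] mult_left_mono[OF exp_weight_mono[OF abs_grid_le r(1), of n t] \<open>0 \<le> C\<close>]
      by linarith
    show "(\<lambda>n. F (grid n t)) \<longlonglongrightarrow> F t" for t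
      using F grid_tendsto[of t] by (auto intro!: continuous_on_tendsto_compose[of UNIV F])
    show "polar_density \<mu> \<in> borel_measurable (variation_measure \<mu>)"
      using polar_density(1) measurable_cong_sets[OF sets_variation_measure refl] by blast
  qed (simp_all add: variation.finite_measure_axioms polar_density simple_function_grid)
  have "(\<lambda>n. riemann_sum n \<mu> F) \<longlonglongrightarrow> x"
    using x(2) by (simp add: riemann_sum_def polar_density(3) grid_sets)
  then show ?thesis
    using bochner_eq[OF x(1)] by (simp add: quat_measure_integral_def)
qed

section \<open>Domination, and linearity in the measure\<close>

lemma total_variation_least:
  assumes N: "sets N = sets borel" and le: "\<And>A. A \<in> sets borel \<Longrightarrow> ennreal (norm (\<mu> A)) \<le> emeasure N A"
  shows "total_variation \<mu> A \<le> emeasure N A"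
  unfolding total_variation_def
proof (rule SUP_least)
  fix P :: "nat \<Rightarrow> real set"
  assume "P \<in> {P. range P \<subseteq> sets borel \<and> disjoint_family P \<and> (\<Union>i. P i) = A}"
  then have P: "\<And>i. P i \<in> sets borel" "range P \<subseteq> sets N" "disjoint_family P" "(\<Union>i. P i) = A"
    using N by auto
  have "(\<Sum>i. ennreal (norm (\<mu> (P i)))) \<le> (\<Sum>i. emeasure N (P i))"
    using le P(1) by (intro suminf_le) auto
  also have "\<dots> = emeasure N A"
    using P by (simp add: suminf_emeasure)
  finally show "(\<Sum>i. ennreal (norm (\<mu> (P i)))) \<le> emeasure N A" .
qed

text \<open>Turns a bound on single values of \<open>\<mu>\<close> into an exponential moment. For
  \<open>a * \<mu>\<close> the dominating measure is the scaled variation, for a convolution the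
  image of the product of the variations under addition.\<close>

lemma exp_integrable_dominated:
  assumes \<mu>: "quat_measure \<mu>" and N: "sets N = sets borel"
    and le: "\<And>A. A \<in> sets borel \<Longrightarrow> ennreal (norm (\<mu> A)) \<le> emeasure N A"
    and fin: "(\<integral>\<^sup>+t. ennreal (exp (r * \<bar>t\<bar>)) \<partial>N) < \<infinity>"
  shows "exp_integrable r \<mu>"
proof -
  have "variation_measure \<mu> \<le> N"
  proof (subst le_measure)
    show "\<forall>A\<in>sets (variation_measure \<mu>). emeasure (variation_measure \<mu>) A \<le> emeasure N A"
      using total_variation_least[OF N le] by (simp add: emeasure_variation_measure[OF \<mu>])
  qed (simp add: N)
  then have "(\<integral>\<^sup>+t. ennreal (exp (r * \<bar>t\<bar>)) \<partial>variation_measure \<mu>) \<le> (\<integral>\<^sup>+t. ennreal (exp (r * \<bar>t\<bar>)) \<partial>N)"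
    by (intro nn_integral_mono_measure) (simp_all add: N)
  then show ?thesis
    unfolding exp_integrable_def using fin by (rule le_less_trans)
qed

lemma quat_measure_cmult:
  assumes "quat_measure \<mu>"
  shows "quat_measure (\<lambda>A. a * \<mu> A)"
  using assms unfolding quat_measure_def by (auto intro!: sums_mult)

lemma quat_measure_add:
  assumes "quat_measure \<mu>" "quat_measure \<nu>"
  shows "quat_measure (\<lambda>A. \<mu> A + \<nu> A)"
  using assms unfolding quat_measure_def by (auto intro!: sums_add)

lemma exp_integrable_cmult:
  assumes "quat_measure \<mu>" "exp_integrable r \<mu>"
  shows "exp_integrable r (\<lambda>A. a * \<mu> A)"
proof (rule exp_integrable_dominated)
  let ?N = "scale_measure (ennreal (norm a)) (variation_measure \<mu>)"
  show "ennreal (norm (a * \<mu> A)) \<le> emeasure ?N A" if "A \<in> sets borel" for A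
    using norm_le_total_variation[OF assms(1) that]
    by (simp add: norm_mult ennreal_mult emeasure_variation_measure assms(1) that mult_left_mono)
  show "(\<integral>\<^sup>+t. ennreal (exp (r * \<bar>t\<bar>)) \<partial>?N) < \<infinity>"
    using assms(2) by (simp add: nn_integral_scale_measure exp_integrable_def ennreal_mult_less_top)
qed (simp_all add: quat_measure_cmult assms)

text \<open>Works in place of a sum measure \<open>M + N\<close>: the inequality for sets extends to
  nonnegative functions by the usual induction from indicators to monotone limits.\<close>

lemma nn_integral_le_add_measure:
  assumes [measurable_cong]: "sets M = sets K" "sets N = sets K" and f: "f \<in> borel_measurable K"
    and le: "\<And>A. A \<in> sets K \<Longrightarrow> emeasure K A \<le> emeasure M A + emeasure N A"
  shows "(\<integral>\<^sup>+x. f x \<partial>K) \<le> (\<integral>\<^sup>+x. f x \<partial>M) + (\<integral>\<^sup>+x. f x \<partial>N)"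
proof -
  have sp [simp]: "space M = space K" "space N = space K"
    using assms sets_eq_imp_space_eq by blast+
  show ?thesis
    using f
  proof (induction f)
    case (cong f g)
    then show ?case
      by (simp cong: nn_integral_cong_simp)
  next
    case (set A)
    then show ?case
      by (simp add: le assms)
  next
    case (mult u c)
    then have [measurable]: "u \<in> borel_measurable K"
      by simp
    have "(\<integral>\<^sup>+x. c * u x \<partial>K) = c * (\<integral>\<^sup>+x. u x \<partial>K)"
      by (simp add: nn_integral_cmult)
    also have "\<dots> \<le> c * ((\<integral>\<^sup>+x. u x \<partial>M) + (\<integral>\<^sup>+x. u x \<partial>N))"
      using mult by (intro mult_left_mono) auto
    finally show ?case
      by (simp add: nn_integral_cmult distrib_left)
  next
    case (add u v)
    then have [measurable]: "u \<in> borel_measurable K" "v \<in> borel_measurable K"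
      by simp_all
    show ?case
      using add_mono[OF add.IH] by (simp add: nn_integral_add ac_simps)
  next
    case (seq U)
    then have [measurable]: "U i \<in> borel_measurable K" for i
      by simp
    have "(\<integral>\<^sup>+x. (SUP i. U i) x \<partial>K) = (SUP i. \<integral>\<^sup>+x. U i x \<partial>K)"
      using seq by (simp add: nn_integral_monotone_convergence_SUP image_comp)
    also have "\<dots> \<le> (\<integral>\<^sup>+x. (SUP i. U i) x \<partial>M) + (\<integral>\<^sup>+x. (SUP i. U i) x \<partial>N)"
    proof (rule SUP_least)
      fix i
      have "(\<integral>\<^sup>+x. U i x \<partial>L) \<le> (\<integral>\<^sup>+x. (SUP i. U i) x \<partial>L)" for L
        by (intro nn_integral_mono) (auto intro: SUP_upper)
      from order_trans[OF seq.IH add_mono[OF this this]]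
      show "(\<integral>\<^sup>+x. U i x \<partial>K) \<le> (\<integral>\<^sup>+x. (SUP i. U i) x \<partial>M) + (\<integral>\<^sup>+x. (SUP i. U i) x \<partial>N)" .
    qed
    finally show ?case .
  qed
qed

lemma exp_integrable_add:
  assumes "quat_measure \<mu>" "exp_integrable r \<mu>" "quat_measure \<nu>" "exp_integrable r \<nu>"
  shows "exp_integrable r (\<lambda>A. \<mu> A + \<nu> A)"
proof -
  let ?K = "variation_measure (\<lambda>A. \<mu> A + \<nu> A)"
  have K: "quat_measure (\<lambda>A. \<mu> A + \<nu> A)"
    using assms by (simp add: quat_measure_add)
  have tv: "total_variation (\<lambda>A. \<mu> A + \<nu> A) A \<le> total_variation \<mu> A + total_variation \<nu> A" for A
    unfolding total_variation_def[of "\<lambda>A. \<mu> A + \<nu> A"]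
  proof (rule SUP_least)
    fix P :: "nat \<Rightarrow> real set"
    assume P: "P \<in> {P. range P \<subseteq> sets borel \<and> disjoint_family P \<and> (\<Union>i. P i) = A}"
    have "(\<Sum>i. ennreal (norm (\<mu> (P i) + \<nu> (P i))))
        \<le> (\<Sum>i. ennreal (norm (\<mu> (P i))) + ennreal (norm (\<nu> (P i))))"
      by (intro suminf_le) (simp_all add: norm_triangle_ineq ennreal_leI flip: ennreal_plus)
    also have "\<dots> = (\<Sum>i. ennreal (norm (\<mu> (P i)))) + (\<Sum>i. ennreal (norm (\<nu> (P i))))"
      by (intro suminf_add[symmetric]) auto
    also have "\<dots> \<le> total_variation \<mu> A + total_variation \<nu> A"
      unfolding total_variation_def by (intro add_mono SUP_upper P)
    finally show "(\<Sum>i. ennreal (norm (\<mu> (P i) + \<nu> (P i)))) \<le> total_variation \<mu> A + total_variation \<nu> A" .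
  qed
  have "(\<integral>\<^sup>+t. ennreal (exp (r * \<bar>t\<bar>)) \<partial>?K)
      \<le> (\<integral>\<^sup>+t. ennreal (exp (r * \<bar>t\<bar>)) \<partial>variation_measure \<mu>)
        + (\<integral>\<^sup>+t. ennreal (exp (r * \<bar>t\<bar>)) \<partial>variation_measure \<nu>)"
    using tv by (intro nn_integral_le_add_measure)
      (simp_all add: emeasure_variation_measure assms K)
  also have "\<dots> < \<infinity>"
    using assms(2,4) by (simp add: exp_integrable_def)
  finally show ?thesis
    by (simp add: exp_integrable_def)
qed

text \<open>All three identities hold for Riemann sums, where no polar density appears, and pass to
  the limit. The third rests on the commutation of left and right multiplication in a
  bimodule.\<close>

lemma
  fixes F :: "real \<Rightarrow> 'v::two_sided_quat_banach"
  assumes \<mu>: "quat_measure \<mu>" "exp_integrable r \<mu>" and r: "r \<ge> 0"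
    and F: "continuous_on UNIV F" "\<And>t. norm (F t) \<le> C * exp (r * \<bar>t\<bar>)"
  shows quat_measure_integral_cmult:
      "quat_measure_integral (\<lambda>A. a * \<mu> A) F = a *\<^sub>l quat_measure_integral \<mu> F"
    and quat_measure_integral_add:
      "quat_measure \<nu> \<Longrightarrow> exp_integrable r \<nu> \<Longrightarrow>
        quat_measure_integral (\<lambda>A. \<mu> A + \<nu> A) F = quat_measure_integral \<mu> F + quat_measure_integral \<nu> F"
    and quat_measure_integral_qscaleR:
      "quat_measure_integral \<mu> (\<lambda>t. F t *\<^sub>r a) = quat_measure_integral \<mu> F *\<^sub>r a"
proof -
  note lim = finite_quat_measure.riemann_sum_tendsto[OF finite_quat_measureI[OF _ _ r] F r]
  have "riemann_sum n (\<lambda>A. a * \<mu> A) F = a *\<^sub>l riemann_sum n \<mu> F" for n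
    by (simp add: riemann_sum_def qscaleL.sum_right qscaleL_qscaleL)
  then have "(\<lambda>n. riemann_sum n (\<lambda>A. a * \<mu> A) F) \<longlonglongrightarrow> a *\<^sub>l quat_measure_integral \<mu> F"
    using \<mu> by (auto intro!: qscaleL.tendsto lim)
  then show "quat_measure_integral (\<lambda>A. a * \<mu> A) F = a *\<^sub>l quat_measure_integral \<mu> F"
    using lim[OF quat_measure_cmult[OF \<mu>(1)] exp_integrable_cmult[OF \<mu>] exp_integrable_cmult[OF \<mu>]]
    by (intro LIMSEQ_unique)
  have bl: "bounded_linear (\<lambda>v::'v. v *\<^sub>r a)"
  proof (rule bounded_linear_intro[where K="norm a"])
    fix v :: 'v and c :: real
    show "(c *\<^sub>R v) *\<^sub>r a = c *\<^sub>R (v *\<^sub>r a)"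
      by (metis qscaleL_of_real qscaleL_qscaleR)
  qed (simp_all add: qscaleR_add_left norm_qscaleR)
  have "riemann_sum n \<mu> (\<lambda>t. F t *\<^sub>r a) = riemann_sum n \<mu> F *\<^sub>r a" for n
    by (simp add: riemann_sum_def bounded_linear.linear[OF bl, THEN linear_sum] qscaleL_qscaleR)
  then have "(\<lambda>n. riemann_sum n \<mu> (\<lambda>t. F t *\<^sub>r a)) \<longlonglongrightarrow> quat_measure_integral \<mu> F *\<^sub>r a"
    using \<mu> by (auto intro!: bounded_linear.tendsto[OF bl] lim)
  moreover have "(\<lambda>n. riemann_sum n \<mu> (\<lambda>t. F t *\<^sub>r a)) \<longlonglongrightarrow> quat_measure_integral \<mu> (\<lambda>t. F t *\<^sub>r a)"
  proof (rule finite_quat_measure.riemann_sum_tendsto[OF finite_quat_measureI[OF \<mu> r] _ _ r \<mu>(2)])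
    show "continuous_on UNIV (\<lambda>t. F t *\<^sub>r a)"
      using bounded_linear.continuous_on[OF bl F(1)] .
    show "norm (F t *\<^sub>r a) \<le> (C * norm a) * exp (r * \<bar>t\<bar>)" for t
      using mult_right_mono[OF F(2)[of t], of "norm a"] by (simp add: norm_qscaleR ac_simps)
  qed
  ultimately show "quat_measure_integral \<mu> (\<lambda>t. F t *\<^sub>r a) = quat_measure_integral \<mu> F *\<^sub>r a"
    by (intro LIMSEQ_unique)
  assume \<nu>: "quat_measure \<nu>" "exp_integrable r \<nu>"
  have "riemann_sum n (\<lambda>A. \<mu> A + \<nu> A) F = riemann_sum n \<mu> F + riemann_sum n \<nu> F" for n
    by (simp add: riemann_sum_def qscaleL.add_left sum.distrib)
  then have "(\<lambda>n. riemann_sum n (\<lambda>A. \<mu> A + \<nu> A) F) \<longlonglongrightarrow>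
      quat_measure_integral \<mu> F + quat_measure_integral \<nu> F"
    using \<mu> \<nu> by (auto intro!: tendsto_add lim)
  then show "quat_measure_integral (\<lambda>A. \<mu> A + \<nu> A) F = quat_measure_integral \<mu> F + quat_measure_integral \<nu> F"
    using lim[OF quat_measure_add[OF \<mu>(1) \<nu>(1)] exp_integrable_add[OF \<mu> \<nu>] exp_integrable_add[OF \<mu> \<nu>]]
    by (intro LIMSEQ_unique)
qed

section \<open>Convolution\<close>

text \<open>The density of the product of \<open>\<mu>\<close> and \<open>\<nu>\<close> with respect
  to the product of their variations; the order of the factors matters.\<close>

definition product_density :: "(real set \<Rightarrow> quat) \<Rightarrow> (real set \<Rightarrow> quat) \<Rightarrow> real \<times> real \<Rightarrow> quat"
  where "product_density \<mu> \<nu> p = polar_density \<mu> (fst p) * polar_density \<nu> (snd p)"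

text \<open>The image of the product measure under addition. The value 0 off the Borel sets is part
  of \<open>quat_measure\<close>.\<close>

definition quat_convolution :: "(real set \<Rightarrow> quat) \<Rightarrow> (real set \<Rightarrow> quat) \<Rightarrow> real set \<Rightarrow> quat"
  where "quat_convolution \<mu> \<nu> A = (if A \<in> sets borel
    then LINT p:(\<lambda>p. fst p + snd p) -` A|variation_measure \<mu> \<Otimes>\<^sub>M variation_measure \<nu>. product_density \<mu> \<nu> p
    else 0)"

locale finite_quat_measure_pair =
  \<mu>: finite_quat_measure \<mu> + \<nu>: finite_quat_measure \<nu> for \<mu> \<nu> :: "real set \<Rightarrow> quat"
begin

abbreviation "variation_product \<equiv> variation_measure \<mu> \<Otimes>\<^sub>M variation_measure \<nu>"

sublocale product: finite_measure variation_product
  by (intro finite_measure_pair_measure \<mu>.variation.finite_measure_axioms \<nu>.variation.finite_measure_axioms)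

sublocale product: pair_sigma_finite "variation_measure \<mu>" "variation_measure \<nu>"
  by unfold_locales

lemma sets_variation_product [measurable_cong]: "sets variation_product = sets (borel \<Otimes>\<^sub>M borel)"
  by (intro sets_pair_measure_cong) simp_all

lemma space_variation_product [simp]: "space variation_product = UNIV"
  by (simp add: space_pair_measure)

lemma borel_measurable_polar [measurable]:
  "polar_density \<mu> \<in> borel_measurable borel" "polar_density \<nu> \<in> borel_measurable borel"
  by (rule \<mu>.polar_density \<nu>.polar_density)+

lemma borel_measurable_product_density [measurable]: "product_density \<mu> \<nu> \<in> borel_measurable variation_product"
  unfolding product_density_def by measurable

lemma norm_product_density: "norm (product_density \<mu> \<nu> p) = 1"
  by (simp add: product_density_def norm_mult \<mu>.polar_density \<nu>.polar_density)

lemma integrable_product_density: "integrable variation_product (product_density \<mu> \<nu>)"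
  by (intro product.integrable_const_bound[of _ 1]) (auto simp: norm_product_density)

lemma vimage_sum_measurable:
  assumes [measurable]: "A \<in> sets borel"
  shows "(\<lambda>p::real \<times> real. fst p + snd p) -` A \<in> sets variation_product"
proof -
  have "(\<lambda>p. fst p + snd p) \<in> borel_measurable variation_product"
    by measurable
  from measurable_sets[OF this assms] show ?thesis
    by simp
qed

text \<open>Fubini with the order of factors preserved: the density of \<open>\<mu>\<close> leaves
  the inner integral on the left, the value of \<open>\<nu>\<close> leaves the outer one on the
  right.\<close>

lemma product_integral_Times:
  assumes A: "A \<in> sets borel" and B: "B \<in> sets borel"
  shows "(LINT p:A \<times> B|variation_product. product_density \<mu> \<nu> p) = \<mu> A * \<nu> B"
proof -
  let ?h = "\<lambda>t. indicator A t *\<^sub>R polar_density \<mu> t" and ?k = "\<lambda>s. indicator B s *\<^sub>R polar_density \<nu> s"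
  have h: "integrable (variation_measure \<mu>) ?h"
    using A by (intro \<mu>.variation.integrable_const_bound[of _ 1])
      (auto simp: \<mu>.polar_density indicator_def)
  have k: "integrable (variation_measure \<nu>) ?k"
    using B by (intro \<nu>.variation.integrable_const_bound[of _ 1])
      (auto simp: \<nu>.polar_density indicator_def)
  have "A \<times> B \<in> sets variation_product"
    using A B by (intro pair_measureI) auto
  then have int: "integrable variation_product (\<lambda>p. indicator (A \<times> B) p *\<^sub>R product_density \<mu> \<nu> p)"
    by (intro integrable_mult_indicator integrable_product_density)
  have "(LINT p:A \<times> B|variation_product. product_density \<mu> \<nu> p)
      = (LINT t|variation_measure \<mu>. LINT s|variation_measure \<nu>.
          indicator (A \<times> B) (t, s) *\<^sub>R product_density \<mu> \<nu> (t, s))"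
    unfolding set_lebesgue_integral_def using product.integral_fst'[OF int] by simp
  also have "\<dots> = (LINT t|variation_measure \<mu>. LINT s|variation_measure \<nu>. ?h t * ?k s)"
    by (intro Bochner_Integration.integral_cong) (auto simp: indicator_def product_density_def)
  also have "\<dots> = (LINT t|variation_measure \<mu>. ?h t * \<nu> B)"
    using integral_bounded_linear[OF bounded_linear_mult_right k] \<nu>.polar_density(3)[OF B]
    by (simp only: set_lebesgue_integral_def)
  also have "\<dots> = \<mu> A * \<nu> B"
    using integral_bounded_linear[OF bounded_linear_mult_left h] \<mu>.polar_density(3)[OF A]
    by (simp only: set_lebesgue_integral_def)
  finally show ?thesis .
qed

text \<open>The density has modulus 1. This estimate supplies both the summability in
  \<open>quat_measure_convolution\<close> and the dominating measure for the exponential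
  moment.\<close>

lemma norm_convolution_le:
  assumes "A \<in> sets borel"
  shows "norm (quat_convolution \<mu> \<nu> A) \<le> measure variation_product ((\<lambda>p. fst p + snd p) -` A)"
proof -
  let ?B = "(\<lambda>p::real \<times> real. fst p + snd p) -` A"
  have "norm (quat_convolution \<mu> \<nu> A) \<le> (LINT p|variation_product. norm (indicator ?B p *\<^sub>R product_density \<mu> \<nu> p))"
    using assms integral_norm_bound[of variation_product "\<lambda>p. indicator ?B p *\<^sub>R product_density \<mu> \<nu> p"]
    unfolding quat_convolution_def set_lebesgue_integral_def by (simp only: if_True)
  also have "\<dots> = (LINT p|variation_product. indicator ?B p)"
    by (simp add: norm_product_density)
  also have "\<dots> = measure variation_product ?B"
    using vimage_sum_measurable[OF assms] by simp
  finally show ?thesis .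
qed

lemma quat_measure_convolution: "quat_measure (quat_convolution \<mu> \<nu>)"
  unfolding quat_measure_def
proof (intro conjI allI impI)
  fix A :: "nat \<Rightarrow> real set" assume "range A \<subseteq> sets borel" and dis: "disjoint_family A"
  then have A: "A i \<in> sets borel" for i
    by auto
  let ?B = "\<lambda>i. (\<lambda>p::real \<times> real. fst p + snd p) -` A i"
  have UN: "(\<lambda>p::real \<times> real. fst p + snd p) -` (\<Union>i. A i) = (\<Union>i. ?B i)"
    by auto
  have B_dis: "?B i \<inter> ?B j = {}" if "i \<noteq> j" for i j
    using disjoint_family_onD[OF dis, of i j] that by auto
  have "summable (\<lambda>i. measure variation_product (?B i))"
    using product.finite_measure_UNION[of ?B] vimage_sum_measurable[OF A] B_dis
    by (auto simp: disjoint_family_on_def intro: sums_summable)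
  then have "summable (\<lambda>i. quat_convolution \<mu> \<nu> (A i))"
    by (rule summable_comparison_test[rotated]) (use norm_convolution_le[OF A] in auto)
  moreover have "(\<Sum>i. quat_convolution \<mu> \<nu> (A i)) = quat_convolution \<mu> \<nu> (\<Union>i. A i)"
  proof -
    have "(\<Union>i. A i) \<in> sets borel"
      using A by (simp add: sets.countable_UN')
    from vimage_sum_measurable[OF this]
    have "set_integrable variation_product (\<Union>i. ?B i) (product_density \<mu> \<nu>)"
      unfolding set_integrable_def UN by (intro integrable_mult_indicator integrable_product_density)
    from lebesgue_integral_countable_add[OF vimage_sum_measurable[OF A] B_dis this]
    have "(LINT p:(\<Union>i. ?B i)|variation_product. product_density \<mu> \<nu> p)
        = (\<Sum>i. LINT p:?B i|variation_product. product_density \<mu> \<nu> p)"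
      by simp
    then show ?thesis
      using A by (simp add: quat_convolution_def UN sets.countable_UN')
  qed
  ultimately show "(\<lambda>i. quat_convolution \<mu> \<nu> (A i)) sums quat_convolution \<mu> \<nu> (\<Union>i. A i)"
    by (simp add: sums_iff)
qed (simp add: quat_convolution_def)

lemma nn_integral_product_exp:
  "(\<integral>\<^sup>+p. ennreal (exp (r * \<bar>fst p\<bar>) * exp (r * \<bar>snd p\<bar>)) \<partial>variation_product)
    = (\<integral>\<^sup>+t. ennreal (exp (r * \<bar>t\<bar>)) \<partial>variation_measure \<mu>) * (\<integral>\<^sup>+t. ennreal (exp (r * \<bar>t\<bar>)) \<partial>variation_measure \<nu>)"
proof -
  have "(\<integral>\<^sup>+p. ennreal (exp (r * \<bar>fst p\<bar>) * exp (r * \<bar>snd p\<bar>)) \<partial>variation_product)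
      = (\<integral>\<^sup>+t. (\<integral>\<^sup>+s. ennreal (exp (r * \<bar>t\<bar>)) * ennreal (exp (r * \<bar>s\<bar>)) \<partial>variation_measure \<nu>) \<partial>variation_measure \<mu>)"
    by (subst \<nu>.variation.nn_integral_fst[symmetric]) (auto simp: ennreal_mult)
  also have "\<dots> = (\<integral>\<^sup>+t. ennreal (exp (r * \<bar>t\<bar>)) \<partial>variation_measure \<mu>)
      * (\<integral>\<^sup>+t. ennreal (exp (r * \<bar>t\<bar>)) \<partial>variation_measure \<nu>)"
    by (simp add: nn_integral_cmult nn_integral_multc)
  finally show ?thesis .
qed

text \<open>The weight is submultiplicative under addition, so the moment of the convolution is at
  most the product of the two moments.\<close>

lemma exp_integrable_convolution:
  assumes "r \<ge> 0" "exp_integrable r \<mu>" "exp_integrable r \<nu>"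
  shows "exp_integrable r (quat_convolution \<mu> \<nu>)"
proof (rule exp_integrable_dominated[OF quat_measure_convolution])
  let ?N = "distr variation_product borel (\<lambda>p. fst p + snd p)"
  show "sets ?N = sets borel"
    by simp
  show "ennreal (norm (quat_convolution \<mu> \<nu> A)) \<le> emeasure ?N A" if A: "A \<in> sets borel" for A
    using norm_convolution_le[OF A] A
    by (simp add: emeasure_distr product.emeasure_eq_measure ennreal_leI)
  have "(\<integral>\<^sup>+t. ennreal (exp (r * \<bar>t\<bar>)) \<partial>?N) = (\<integral>\<^sup>+p. ennreal (exp (r * \<bar>fst p + snd p\<bar>)) \<partial>variation_product)"
    by (simp add: nn_integral_distr)
  also have "\<dots> \<le> (\<integral>\<^sup>+p. ennreal (exp (r * \<bar>fst p\<bar>) * exp (r * \<bar>snd p\<bar>)) \<partial>variation_product)"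
    using exp_weight_sum_le[OF assms(1)] by (intro nn_integral_mono ennreal_leI)
  also have "\<dots> < \<infinity>"
    using assms(2,3) by (simp add: nn_integral_product_exp exp_integrable_def ennreal_mult_less_top)
  finally show "(\<integral>\<^sup>+t. ennreal (exp (r * \<bar>t\<bar>)) \<partial>?N) < \<infinity>" .
qed

lemma integrable_product_exp:
  assumes "exp_integrable r \<mu>" "exp_integrable r \<nu>"
  shows "integrable variation_product (\<lambda>p. exp (r * \<bar>fst p\<bar>) * exp (r * \<bar>snd p\<bar>))"
  using assms by (intro integrableI_nonneg)
    (auto simp: nn_integral_product_exp exp_integrable_def ennreal_mult_less_top)

text \<open>Rounding \<open>t + s\<close> and rounding \<open>t\<close> and \<open>s\<close> separately yield two simple approximations of the
  same Bochner integral over the plane, hence the same limit.\<close>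

lemma product_riemann_sum_tendsto:
  fixes G :: "real \<Rightarrow> 'v::two_sided_quat_banach"
  assumes G: "continuous_on UNIV G" "\<And>t. norm (G t) \<le> C * exp (r * \<bar>t\<bar>)"
    and r: "r \<ge> 0" "exp_integrable r \<mu>" "exp_integrable r \<nu>"
  shows "(\<lambda>n. \<Sum>y\<in>range (grid n). \<Sum>z\<in>range (grid n). (\<mu> (grid n -` {y}) * \<nu> (grid n -` {z})) *\<^sub>l G (y + z))
    \<longlonglongrightarrow> quat_measure_integral (quat_convolution \<mu> \<nu>) G"
proof -
  have C: "0 \<le> C"
    using order_trans[OF norm_ge_zero G(2)[of 0]] by simp
  let ?w = "\<lambda>p::real \<times> real. C * (exp (r * \<bar>fst p\<bar>) * exp (r * \<bar>snd p\<bar>))"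
  have w: "integrable variation_product ?w"
    using integrable_product_exp[OF r(2,3)] by simp
  \<comment> \<open>One bound for both discretizations: \<open>v\<close> and \<open>v'\<close> are
    the coordinates themselves when the sum is rounded, and the rounded coordinates
    otherwise.\<close>
  have G_le: "norm (G u) \<le> ?w p" if "\<bar>u\<bar> \<le> \<bar>v\<bar> + \<bar>v'\<bar>" "\<bar>v\<bar> \<le> \<bar>fst p\<bar>" "\<bar>v'\<bar> \<le> \<bar>snd p\<bar>" for u v v' p
  proof -
    have "r * \<bar>u\<bar> \<le> r * (\<bar>fst p\<bar> + \<bar>snd p\<bar>)"
      using that r(1) by (intro mult_left_mono) auto
    then have "C * exp (r * \<bar>u\<bar>) \<le> ?w p"
      using C by (intro mult_left_mono) (simp_all add: exp_add[symmetric] distrib_left)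
    then show ?thesis
      using G(2)[of u] by linarith
  qed
  have G_lim: "(\<lambda>n. G (u n)) \<longlonglongrightarrow> G x" if "u \<longlonglongrightarrow> x" for u x
    using G(1) that by (auto intro!: continuous_on_tendsto_compose[of UNIV G])
  let ?D = "\<lambda>n p. grid n (fst p + snd p)" and ?E = "\<lambda>n p. (grid n (fst p), grid n (snd p))"
  note bochner_limit = has_bochner_fibre_limit[OF product.finite_measure_axioms
      borel_measurable_product_density, where f="\<lambda>p. G (fst p + snd p)" and w="?w"]
  obtain x where x: "has_bochner variation_product (\<lambda>p. product_density \<mu> \<nu> p *\<^sub>l G (fst p + snd p)) x"
    "(\<lambda>n. \<Sum>y\<in>?D n ` space variation_product.
      (LINT p:?D n -` {y} \<inter> space variation_product|variation_product. product_density \<mu> \<nu> p) *\<^sub>l G y) \<longlonglongrightarrow> x"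
  proof (rule bochner_limit[where F=G and D="?D"])
    show "simple_function variation_product (?D n)" for n
      by (rule simple_function_comp[OF _ simple_function_grid[of borel]]) (simp_all add: space_pair_measure)
    show "norm (G (?D n p)) \<le> ?w p" for n p
      using abs_grid_le[of n "fst p + snd p"] abs_triangle_ineq[of "fst p" "snd p"]
      by (intro G_le[of _ "fst p" "snd p"]) linarith+
    show "(\<lambda>n. G (?D n p)) \<longlonglongrightarrow> G (fst p + snd p)" for p
      by (intro G_lim grid_tendsto)
  qed (use w norm_product_density in auto)
  obtain x' where x': "has_bochner variation_product (\<lambda>p. product_density \<mu> \<nu> p *\<^sub>l G (fst p + snd p)) x'"
    "(\<lambda>n. \<Sum>y\<in>?E n ` space variation_product.
      (LINT p:?E n -` {y} \<inter> space variation_product|variation_product. product_density \<mu> \<nu> p) *\<^sub>l G (fst y + snd y)) \<longlonglongrightarrow> x'"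
  proof (rule bochner_limit[where F="\<lambda>y. G (fst y + snd y)" and D="?E"])
    show "simple_function variation_product (?E n)" for n
    proof (rule simple_function_Pair)
      show "simple_function variation_product (\<lambda>p. grid n (fst p))"
        by (rule simple_function_comp[OF _ simple_function_grid[of borel]]) simp_all
      show "simple_function variation_product (\<lambda>p. grid n (snd p))"
        by (rule simple_function_comp[OF _ simple_function_grid[of borel]]) simp_all
    qed
    show "norm (G (fst (?E n p) + snd (?E n p))) \<le> ?w p" for n p
      using abs_grid_le[of n "fst p"] abs_grid_le[of n "snd p"]
        abs_triangle_ineq[of "grid n (fst p)" "grid n (snd p)"]
      by (intro G_le[of _ "grid n (fst p)" "grid n (snd p)"]) auto
    show "(\<lambda>n. G (fst (?E n p) + snd (?E n p))) \<longlonglongrightarrow> G (fst p + snd p)" for p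
      using tendsto_add[OF grid_tendsto grid_tendsto] by (intro G_lim) simp
  qed (use w norm_product_density in auto)
  \<comment> \<open>Every real is the sum of a pair with second entry 0.\<close>
  have "range (?D n) = range (grid n)" for n
    by (force intro: rev_image_eqI[of "(_, 0)"])
  moreover have "?D n -` {y} = (\<lambda>p. fst p + snd p) -` (grid n -` {y})" for n y
    by auto
  ultimately have "(\<lambda>n. riemann_sum n (quat_convolution \<mu> \<nu>) G) \<longlonglongrightarrow> x"
    using x(2) grid_sets by (simp add: riemann_sum_def quat_convolution_def)
  moreover have "(\<lambda>n. riemann_sum n (quat_convolution \<mu> \<nu>) G)
      \<longlonglongrightarrow> quat_measure_integral (quat_convolution \<mu> \<nu>) G"
    by (rule finite_quat_measure.riemann_sum_tendsto[OF finite_quat_measureI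
          [OF quat_measure_convolution exp_integrable_convolution[OF r] r(1)]
          G r(1) exp_integrable_convolution[OF r]])
  ultimately have conv: "quat_measure_integral (quat_convolution \<mu> \<nu>) G = x'"
    using LIMSEQ_unique has_bochner_unique[OF x(1) x'(1)] by blast
  have "range (?E n) = range (grid n) \<times> range (grid n)" for n
  proof (intro equalityI subsetI)
    fix y assume "y \<in> range (grid n) \<times> range (grid n)"
    then obtain s t where "y = ?E n (s, t)"
      by auto
    then show "y \<in> range (?E n)"
      by (rule range_eqI)
  qed auto
  moreover have "?E n -` {y} = grid n -` {fst y} \<times> grid n -` {snd y}" for n y
    by (cases y) auto
  ultimately show ?thesis
    using x'(2) grid_sets unfolding conv
    by (simp add: product_integral_Times sum.cartesian_product case_prod_beta)
qed

text \<open>Only a real \<open>\<nu>\<close> can be moved past the operators \<open>Z (- t)\<close>, which are linear from the right but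
  not from the left.\<close>

lemma quat_measure_integral_convolution:
  fixes Z :: "real \<Rightarrow> 'v::two_sided_quat_banach \<Rightarrow> 'v"
  assumes linear: "\<And>t. linear (Z t)" and add: "\<And>s t v. Z (s + t) v = Z s (Z t v)"
    and cont: "\<And>v. continuous_on UNIV (\<lambda>t. Z t v)"
    and bound: "\<And>t v. norm (Z t v) \<le> M * exp (r * \<bar>t\<bar>) * norm v" and "M \<ge> 0"
    and r: "r \<ge> 0" "exp_integrable r \<mu>" "exp_integrable r \<nu>"
    and real: "\<And>A. A \<in> sets borel \<Longrightarrow> \<nu> A \<in> \<real>"
  shows "quat_measure_integral (quat_convolution \<mu> \<nu>) (\<lambda>t. Z (- t) v)
    = quat_measure_integral \<mu> (\<lambda>t. Z (- t) (quat_measure_integral \<nu> (\<lambda>t. Z (- t) v)))"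
proof -
  have cont': "continuous_on UNIV (\<lambda>t. Z (- t) v)" for v
    by (rule continuous_on_compose2[OF cont[of v]]) (auto intro: continuous_intros)
  have bound': "norm (Z (- t) v) \<le> (M * norm v) * exp (r * \<bar>t\<bar>)" for t v
    using bound[of "- t" v] by (simp add: ac_simps)
  define u where "u n = riemann_sum n \<nu> (\<lambda>t. Z (- t) v)" for n
  define U where "U = quat_measure_integral \<nu> (\<lambda>t. Z (- t) v)"
  have u: "u \<longlonglongrightarrow> U"
    unfolding u_def U_def by (rule \<nu>.riemann_sum_tendsto[OF cont' bound' r(1,3)])
  have "(\<mu> (grid n -` {y}) * \<nu> (grid n -` {z})) *\<^sub>l Z (- (y + z)) v
      = \<mu> (grid n -` {y}) *\<^sub>l Z (- y) (\<nu> (grid n -` {z}) *\<^sub>l Z (- z) v)" for n y z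
  proof -
    obtain c where c: "\<nu> (grid n -` {z}) = of_real c"
      using real[OF grid_sets, of n z] by (rule Reals_cases)
    have "Z (- y) (c *\<^sub>R Z (- z) v) = c *\<^sub>R Z (- (y + z)) v"
      using add[of "- y" "- z" v] by (simp add: linear_scale[OF linear])
    then show ?thesis
      by (simp add: c qscaleL_of_real qscaleL_qscaleL[symmetric])
  qed
  \<comment> \<open>The double sum is an outer Riemann sum whose integrand contains the inner sum
    \<open>u n\<close>, so mesh and integrand vary together.\<close>
  then have sums: "(\<Sum>y\<in>range (grid n). \<Sum>z\<in>range (grid n).
      (\<mu> (grid n -` {y}) * \<nu> (grid n -` {z})) *\<^sub>l Z (- (y + z)) v)
    = riemann_sum n \<mu> (\<lambda>t. Z (- t) (u n))" for n
    unfolding riemann_sum_def u_def by (simp add: linear_sum[OF linear] qscaleL.sum_right)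
  have lim: "(\<lambda>n. riemann_sum n \<mu> (\<lambda>t. Z (- t) (u n))) \<longlonglongrightarrow>
      quat_measure_integral (quat_convolution \<mu> \<nu>) (\<lambda>t. Z (- t) v)"
    using product_riemann_sum_tendsto[OF cont'[of v] bound' r] unfolding sums .
  \<comment> \<open>\<open>K\<close> does not depend on the mesh; hence replacing \<open>u n\<close>
    by its limit changes the outer sum by at most \<open>K * norm (u n - U)\<close>.\<close>
  define K where "K = M * (LINT t|variation_measure \<mu>. exp (r * \<bar>t\<bar>))"
  have diff_le: "norm (riemann_sum n \<mu> (\<lambda>t. Z (- t) w)) \<le> K * norm w" for n w
  proof -
    interpret S: finite_measure "variation_measure \<mu>"
      by (rule \<mu>.variation.finite_measure_axioms)
    have "riemann_sum n \<mu> (\<lambda>t. Z (- t) w) = (\<Sum>y\<in>grid n ` space (variation_measure \<mu>).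
        (LINT t:grid n -` {y} \<inter> space (variation_measure \<mu>)|variation_measure \<mu>. polar_density \<mu> t) *\<^sub>l Z (- y) w)"
      using grid_sets by (simp add: riemann_sum_def \<mu>.polar_density(3))
    also have "norm \<dots> \<le> (LINT t|variation_measure \<mu>. norm (polar_density \<mu> t) * norm (Z (- grid n t) w))"
    proof (rule norm_fibre_sum_le[OF \<mu>.variation.finite_measure_axioms])
      show "integrable (variation_measure \<mu>) (polar_density \<mu>)"
        by (intro \<mu>.variation.integrable_const_bound[of _ 1]) (auto simp: \<mu>.polar_density)
    qed (simp add: simple_function_grid)
    also have "\<dots> \<le> (LINT t|variation_measure \<mu>. (M * norm w) * exp (r * \<bar>t\<bar>))"
    proof (rule Bochner_Integration.integral_mono')
      show "integrable (variation_measure \<mu>) (\<lambda>t. (M * norm w) * exp (r * \<bar>t\<bar>))"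
        using integrable_exp_weight[OF r(2)] by simp
      fix t
      have "M * norm w * exp (r * \<bar>grid n t\<bar>) \<le> M * norm w * exp (r * \<bar>t\<bar>)"
        using \<open>M \<ge> 0\<close> by (intro mult_left_mono exp_weight_mono abs_grid_le r) auto
      then show "norm (polar_density \<mu> t) * norm (Z (- grid n t) w) \<le> (M * norm w) * exp (r * \<bar>t\<bar>)"
        using bound'[of "grid n t" w] by (simp add: \<mu>.polar_density)
    qed (use \<open>M \<ge> 0\<close> in simp)
    also have "\<dots> = K * norm w"
      by (simp add: K_def)
    finally show ?thesis .
  qed
  have "(\<lambda>n. riemann_sum n \<mu> (\<lambda>t. Z (- t) (u n)) - riemann_sum n \<mu> (\<lambda>t. Z (- t) U)) \<longlonglongrightarrow> 0"
  proof (rule Lim_null_comparison)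
    have "riemann_sum n \<mu> (\<lambda>t. Z (- t) (u n)) - riemann_sum n \<mu> (\<lambda>t. Z (- t) U)
        = riemann_sum n \<mu> (\<lambda>t. Z (- t) (u n - U))" for n
      by (simp add: riemann_sum_def sum_subtractf[symmetric] qscaleL.diff_right linear_diff[OF linear])
    then show "\<forall>\<^sub>F n in sequentially. norm (riemann_sum n \<mu> (\<lambda>t. Z (- t) (u n)) - riemann_sum n \<mu> (\<lambda>t. Z (- t) U))
        \<le> K * norm (u n - U)"
      using diff_le by simp
    show "(\<lambda>n. K * norm (u n - U)) \<longlonglongrightarrow> 0"
      using u by (intro tendsto_mult_right_zero tendsto_norm_zero) (simp add: LIM_zero_iff)
  qed
  from tendsto_diff[OF lim this] have "(\<lambda>n. riemann_sum n \<mu> (\<lambda>t. Z (- t) U)) \<longlonglongrightarrow>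
      quat_measure_integral (quat_convolution \<mu> \<nu>) (\<lambda>t. Z (- t) v)"
    by simp
  moreover have "(\<lambda>n. riemann_sum n \<mu> (\<lambda>t. Z (- t) U)) \<longlonglongrightarrow> quat_measure_integral \<mu> (\<lambda>t. Z (- t) U)"
    by (rule \<mu>.riemann_sum_tendsto[OF cont' bound' r(1,2)])
  ultimately show ?thesis
    unfolding U_def by (rule LIMSEQ_unique)
qed

end

section \<open>The quaternionic exponential\<close>

text \<open>Every quaternion lies in one of the copies \<open>\<real> + \<real> u\<close> of the complex plane, \<open>u\<^sup>2 = - 1\<close>.\<close>

lemma quat_axis:
  fixes q :: quat
  obtains u y where "norm u = 1" "qRe u = 0" "q = qRe q *\<^sub>R 1 + y *\<^sub>R u"
proof (cases "q = qRe q *\<^sub>R 1")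
  case True
  have "norm (Quat 0 1 0 0) = 1"
    by (simp add: norm_quat_def inner_quat_def)
  then show ?thesis
    using True by (intro that[of "Quat 0 1 0 0" 0]) auto
next
  case False
  let ?v = "q - qRe q *\<^sub>R 1"
  show ?thesis
    using False by (intro that[of "?v /\<^sub>R norm ?v" "norm ?v"]) auto
qed

lemma norm_quat_power2: "(norm q)\<^sup>2 = (qRe q)\<^sup>2 + (qI q)\<^sup>2 + (qJ q)\<^sup>2 + (qK q)\<^sup>2"
  by (simp add: power2_norm_eq_inner inner_quat_def flip: power2_eq_square)

lemma imaginary_unit_square:
  assumes "norm u = 1" "qRe u = 0"
  shows "u * u = - 1"
proof -
  have "(qI u)\<^sup>2 + (qJ u)\<^sup>2 + (qK u)\<^sup>2 = 1"
    using norm_quat_power2[of u] assms by simp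
  then show ?thesis
    using assms(2) by (simp add: quat_eq_iff quat_mult_sel power2_eq_square)
qed

text \<open>For \<open>u * u = - 1\<close> this is a continuous homomorphism of real algebras, so it
  carries the complex exponential, with its known real and imaginary parts, to the quaternionic
  one.\<close>

definition complex_in_plane :: "quat \<Rightarrow> complex \<Rightarrow> quat"
  where "complex_in_plane u z = Re z *\<^sub>R 1 + Im z *\<^sub>R u"

lemma bounded_linear_complex_in_plane: "bounded_linear (complex_in_plane u)"
  unfolding complex_in_plane_def
  by (intro bounded_linear_add bounded_linear_scaleR_const bounded_linear_Re bounded_linear_Im)

lemma complex_in_plane_mult:
  assumes "u * u = - 1"
  shows "complex_in_plane u (w * z) = complex_in_plane u w * complex_in_plane u z"
proof -
  have "complex_in_plane u w * complex_in_plane u z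
      = (Re w * Re z) *\<^sub>R 1 + (Re w * Im z) *\<^sub>R u + (Im w * Re z) *\<^sub>R u + (Im w * Im z) *\<^sub>R (u * u)"
    by (simp add: complex_in_plane_def distrib_left distrib_right scaleR_right_distrib ac_simps)
  then show ?thesis
    by (simp add: assms complex_in_plane_def scaleR_left_diff_distrib scaleR_left_distrib ac_simps)
qed

lemma complex_in_plane_exp:
  assumes "u * u = - 1"
  shows "complex_in_plane u (exp z) = exp (complex_in_plane u z)"
proof -
  have 1: "complex_in_plane u 1 = 1"
    by (simp add: complex_in_plane_def)
  have power: "complex_in_plane u (z ^ n) = complex_in_plane u z ^ n" for n
    by (induction n) (simp_all add: 1 complex_in_plane_mult[OF assms])
  have "complex_in_plane u (exp z) = (\<Sum>n. complex_in_plane u (z ^ n /\<^sub>R fact n))"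
    unfolding exp_def
    by (rule bounded_linear.suminf[OF bounded_linear_complex_in_plane summable_exp_generic])
  also have "\<dots> = exp (complex_in_plane u z)"
    unfolding exp_def
    by (simp only: power linear_scale[OF bounded_linear.linear[OF bounded_linear_complex_in_plane]])
  finally show ?thesis .
qed

lemma exp_quat_axis:
  assumes "norm u = 1" "qRe u = 0"
  shows "exp (- (t *\<^sub>R (x *\<^sub>R 1 + y *\<^sub>R u))) = exp (- t * x) *\<^sub>R (cos (t * y) *\<^sub>R 1 - sin (t * y) *\<^sub>R u)"
proof -
  have "- (t *\<^sub>R (x *\<^sub>R 1 + y *\<^sub>R u)) = complex_in_plane u (Complex (- t * x) (- t * y))"
    by (simp add: complex_in_plane_def scaleR_right_distrib)
  then show ?thesis
    using complex_in_plane_exp[OF imaginary_unit_square[OF assms], of "Complex (- t * x) (- t * y)"]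
    by (simp add: complex_in_plane_def Re_exp Im_exp scaleR_diff_right)
qed

lemma norm_exp_quat: "norm (exp (- (t *\<^sub>R s) :: quat)) = exp (- t * qRe s)"
proof -
  obtain u y where u: "norm u = 1" "qRe u = 0" and s: "s = qRe s *\<^sub>R 1 + y *\<^sub>R u"
    by (rule quat_axis)
  have "(norm (cos (t * y) *\<^sub>R 1 - sin (t * y) *\<^sub>R u))\<^sup>2
      = (cos (t * y))\<^sup>2 + (sin (t * y))\<^sup>2 * ((qI u)\<^sup>2 + (qJ u)\<^sup>2 + (qK u)\<^sup>2)"
    using u(2) by (simp add: norm_quat_power2 power_mult_distrib algebra_simps)
  also have "\<dots> = 1"
    using norm_quat_power2[of u] u by simp
  finally have "norm (cos (t * y) *\<^sub>R 1 - sin (t * y) *\<^sub>R u) = 1"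
    by (simp add: power2_eq_1_iff) (smt (verit) norm_ge_zero)
  then show ?thesis
    by (subst s) (simp add: exp_quat_axis[OF u] del: scaleR_diff_right)
qed

text \<open>The factor 1 is the constant \<open>C\<close> in the growth condition of
  \<open>riemann_sum_tendsto\<close>.\<close>

lemma norm_exp_quat_le:
  assumes "s \<in> strip r"
  shows "norm (exp (- (t *\<^sub>R s) :: quat)) \<le> 1 * exp (r * \<bar>t\<bar>)"
proof -
  have "- t * qRe s \<le> \<bar>t\<bar> * \<bar>qRe s\<bar>"
    by (metis abs_ge_self abs_minus_cancel abs_mult)
  also have "\<dots> \<le> r * \<bar>t\<bar>"
    using assms by (subst mult.commute, intro mult_right_mono) (auto simp: strip_def)
  finally show ?thesis
    by (simp add: norm_exp_quat)
qed

lemma continuous_on_exp_quat: "continuous_on A (\<lambda>t. exp (- (t *\<^sub>R s) :: quat))"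
proof -
  obtain u y where u: "norm u = 1" "qRe u = 0" and s: "s = qRe s *\<^sub>R 1 + y *\<^sub>R u"
    by (rule quat_axis)
  show ?thesis
    by (subst s) (auto simp: exp_quat_axis[OF u] intro!: continuous_intros)
qed

text \<open>The exponents are real multiples of the same \<open>s\<close> and therefore
  commute.\<close>

lemma exp_quat_add: "exp (- ((t + t') *\<^sub>R s) :: quat) = exp (- (t *\<^sub>R s)) * exp (- (t' *\<^sub>R s))"
  by (subst exp_add_commuting[symmetric]) (simp_all add: scaleR_left_distrib)


section \<open>Uniqueness of the Laplace transform\<close>

text \<open>After division by the total mass of \<open>M\<close>, the densities 1 and
  \<open>1 + g\<close> define probability measures: \<open>1 + g\<close> is nonnegative, and the
  cosine condition at 0 says that \<open>g\<close> has integral 0. Their characteristic functions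
  agree, hence so do the measures.\<close>

lemma signed_density_eq_0_if_fourier_eq_0:
  fixes g :: "real \<Rightarrow> real"
  assumes "finite_measure M" and M: "sets M = sets borel"
    and g: "g \<in> borel_measurable borel" and g1: "\<And>t. \<bar>g t\<bar> \<le> 1"
    and cos: "\<And>y. (LINT t|M. cos (t * y) * g t) = 0" and sin: "\<And>y. (LINT t|M. sin (t * y) * g t) = 0"
    and A: "A \<in> sets borel"
  shows "(LINT t:A|M. g t) = 0"
proof -
  interpret finite_measure M by fact
  note M[measurable_cong] and A[measurable] and g[measurable]
  have sp: "space M = UNIV"
    using sets_eq_imp_space_eq[OF M] by simp
  define c where "c = measure M UNIV"
  show ?thesis
  \<comment> \<open>Normalization needs positive mass; the zero measure is treated apart.\<close>
  proof (cases "c = 0")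
    case True
    then have "emeasure M (space M) = 0"
      by (simp add: sp c_def emeasure_eq_measure)
    then have "AE t in M. False"
      by (intro AE_I[of _ _ "space M"]) auto
    then have "(LINT t:A|M. g t) = (LINT t|M. 0)"
      unfolding set_lebesgue_integral_def by (intro integral_cong_AE) auto
    then show ?thesis
      by simp
  next
    case False
    then have c: "c > 0"
      unfolding c_def by (simp add: less_le measure_nonneg)
    have int: "integrable M f" if "f \<in> borel_measurable borel" "\<And>t. norm (f t) \<le> B"
      for f :: "real \<Rightarrow> 'b::{banach, second_countable_topology}" and B
      using that by (intro integrable_const_bound[of _ B]) auto
    have int_g: "integrable M g"
      using int[OF g, of 1] g1 by simp
    have nonneg: "0 \<le> 1 + g t" for t
      using abs_ge_minus_self[of "g t"] g1[of t] by linarith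
    have g0: "(LINT t|M. g t) = 0"
      using cos[of 0] by simp
    define N where "N k = density M (\<lambda>t. ennreal (k t / c))" for k :: "real \<Rightarrow> real"
    have dist: "real_distribution (N k)" if k: "integrable M k" "\<And>t. 0 \<le> k t" "(LINT t|M. k t) = c" for k
    proof -
      have [measurable]: "k \<in> borel_measurable M"
        using k by simp
      have "emeasure (N k) (space (N k)) = (\<integral>\<^sup>+t. ennreal (k t / c) \<partial>M)"
        by (simp add: N_def emeasure_density sp)
      also have "\<dots> = ennreal (LINT t|M. k t / c)"
        using k c by (intro nn_integral_eq_integral) auto
      also have "\<dots> = 1"
        using k c by simp
      finally have "prob_space (N k)"
        by (rule prob_spaceI)
      then show ?thesis
        by (intro real_distribution.intro real_distribution_axioms.intro) (simp_all add: N_def M)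
    qed
    have 1: "real_distribution (N (\<lambda>t. 1))"
      using int[of "\<lambda>t. 1 :: real" 1] by (intro dist) (simp_all add: c_def sp)
    have 2: "real_distribution (N (\<lambda>t. 1 + g t))"
      using int_g g0 nonneg by (intro dist) (simp_all add: c_def sp)
    \<comment> \<open>Used for complex characters, to equate the characteristic functions, and for a
      real indicator, to read off the conclusion.\<close>
    have lebesgue: "(LINT t|N (\<lambda>t. 1 + g t). f t) = (LINT t|N (\<lambda>t. 1). f t) + (LINT t|M. g t *\<^sub>R f t) /\<^sub>R c"
      if f[measurable]: "f \<in> borel_measurable borel" and B: "\<And>t. norm (f t) \<le> 1"
      for f :: "real \<Rightarrow> 'b::{banach, second_countable_topology}"
    proof -
      have i: "integrable M (\<lambda>t. f t)" "integrable M (\<lambda>t. g t *\<^sub>R f t)"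
        using B mult_mono[OF g1 B] by (auto intro!: int[of _ 1])
      have "(LINT t|N (\<lambda>t. 1 + g t). f t) = (LINT t|M. ((1 + g t) / c) *\<^sub>R f t)"
        unfolding N_def using nonneg c by (intro integral_density) auto
      also have "\<dots> = (LINT t|M. (1 / c) *\<^sub>R f t + (1 / c) *\<^sub>R (g t *\<^sub>R f t))"
        by (intro Bochner_Integration.integral_cong) (simp_all add: add_divide_distrib scaleR_left_distrib)
      also have "\<dots> = (LINT t|M. (1 / c) *\<^sub>R f t) + (1 / c) *\<^sub>R (LINT t|M. g t *\<^sub>R f t)"
        by (simp only: Bochner_Integration.integral_add integral_scaleR_right integrable_scaleR_right i)
      also have "(LINT t|M. (1 / c) *\<^sub>R f t) = (LINT t|N (\<lambda>t. 1). f t)"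
        unfolding N_def using c by (intro integral_density[symmetric]) auto
      finally show ?thesis
        by (simp add: inverse_eq_divide)
    qed
    have "char (N (\<lambda>t. 1 + g t)) = char (N (\<lambda>t. 1))"
    proof
      fix y
      have "(LINT t|M. g t *\<^sub>R iexp (y * t)) = 0"
      proof -
        have i: "integrable M (\<lambda>t. g t *\<^sub>R iexp (y * t))"
          using g1 by (intro int[of _ 1]) auto
        show ?thesis
          using integral_Re[OF i] integral_Im[OF i] cos[of y] sin[of y]
          by (intro complex_eqI) (simp_all add: Re_exp Im_exp ac_simps)
      qed
      then show "char (N (\<lambda>t. 1 + g t)) y = char (N (\<lambda>t. 1)) y"
        using lebesgue[of "\<lambda>t. iexp (y * t)"] by (simp add: char_def)
    qed
    then have "N (\<lambda>t. 1 + g t) = N (\<lambda>t. 1)"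
      by (rule Levy_uniqueness[OF 2 1])
    then have "(LINT t|M. g t *\<^sub>R indicat_real A t) /\<^sub>R c = 0"
      using lebesgue[of "indicat_real A"] by (simp add: indicator_def)
    then show ?thesis
      using c by (simp add: set_lebesgue_integral_def mult.commute)
  qed
qed

context finite_quat_measure
begin

text \<open>Real kernels commute with the density, so the Fourier transform can be split without
  choosing an imaginary unit; the unit enters only in \<open>laplace_imaginary_axis\<close>.\<close>

definition cos_transform :: "real \<Rightarrow> quat"
  where "cos_transform y = (LINT t|variation_measure \<mu>. cos (t * y) *\<^sub>R polar_density \<mu> t)"

definition sin_transform :: "real \<Rightarrow> quat"
  where "sin_transform y = (LINT t|variation_measure \<mu>. sin (t * y) *\<^sub>R polar_density \<mu> t)"

lemma transform_minus: "cos_transform (- y) = cos_transform y" "sin_transform (- y) = - sin_transform y"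
  by (simp_all add: cos_transform_def sin_transform_def)

lemma integrable_transforms:
  "integrable (variation_measure \<mu>) (\<lambda>t. cos (t * y) *\<^sub>R polar_density \<mu> t)"
  "integrable (variation_measure \<mu>) (\<lambda>t. sin (t * y) *\<^sub>R polar_density \<mu> t)"
proof -
  have [measurable]: "polar_density \<mu> \<in> borel_measurable borel"
    by (rule polar_density)
  show "integrable (variation_measure \<mu>) (\<lambda>t. cos (t * y) *\<^sub>R polar_density \<mu> t)"
    "integrable (variation_measure \<mu>) (\<lambda>t. sin (t * y) *\<^sub>R polar_density \<mu> t)"
    by (intro variation.integrable_const_bound[of _ 1]; simp add: polar_density)+
qed

lemma laplace_imaginary_axis:
  assumes u: "norm u = 1" "qRe u = 0"
  shows "laplace \<mu> (y *\<^sub>R u) = cos_transform y - sin_transform y * u"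
proof -
  have "(\<lambda>t. polar_density \<mu> t *\<^sub>l exp (- (t *\<^sub>R (y *\<^sub>R u))))
      = (\<lambda>t. cos (t * y) *\<^sub>R polar_density \<mu> t - (sin (t * y) *\<^sub>R polar_density \<mu> t) * u)"
    using exp_quat_axis[OF u, of _ 0 y] by (simp add: fun_eq_iff qscaleL_quat_def right_diff_distrib)
  moreover have "has_bochner (variation_measure \<mu>)
      (\<lambda>t. cos (t * y) *\<^sub>R polar_density \<mu> t - (sin (t * y) *\<^sub>R polar_density \<mu> t) * u)
      (cos_transform y - sin_transform y * u)"
    unfolding has_bochner_iff_has_bochner_integral cos_transform_def sin_transform_def
    by (intro has_bochner_integral_diff has_bochner_integral_mult_left has_bochner_integral_integrable
        integrable_transforms)
  ultimately show ?thesis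
    unfolding laplace_def quat_measure_integral_def using bochner_eq by metis
qed

text \<open>The real density \<open>polar_density \<mu> t \<bullet> b\<close> is bounded by 1, and
  its Fourier integrals are the \<open>b\<close>-components of the two transforms.\<close>

lemma component_eq_0:
  assumes b: "norm b = 1" and "\<And>y. cos_transform y \<bullet> b = 0" "\<And>y. sin_transform y \<bullet> b = 0"
  shows "\<mu> A \<bullet> b = 0"
proof (cases "A \<in> sets borel")
  case True
  have [measurable]: "polar_density \<mu> \<in> borel_measurable borel"
    by (rule polar_density)
  have i: "integrable (variation_measure \<mu>) (\<lambda>t. indicator A t *\<^sub>R polar_density \<mu> t)"
    using True by (intro variation.integrable_const_bound[of _ 1]) (auto simp: polar_density indicator_def)
  have "(LINT t:A|variation_measure \<mu>. polar_density \<mu> t \<bullet> b) = 0"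
  proof (rule signed_density_eq_0_if_fourier_eq_0[OF variation.finite_measure_axioms])
    show "\<bar>polar_density \<mu> t \<bullet> b\<bar> \<le> 1" for t
      using Cauchy_Schwarz_ineq2[of "polar_density \<mu> t" b] by (simp add: polar_density b)
    show "(LINT t|variation_measure \<mu>. cos (t * y) * (polar_density \<mu> t \<bullet> b)) = 0" for y
      using integrable_transforms(1)[of y] assms(2)[of y]
      by (simp add: cos_transform_def flip: integral_inner_left)
    show "(LINT t|variation_measure \<mu>. sin (t * y) * (polar_density \<mu> t \<bullet> b)) = 0" for y
      using integrable_transforms(2)[of y] assms(3)[of y]
      by (simp add: sin_transform_def flip: integral_inner_left)
  qed (use True in auto)
  then show ?thesis
    using i polar_density(3)[OF True]
    by (simp add: set_lebesgue_integral_def flip: integral_inner_left)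
next
  case False
  then show ?thesis
    using quat_measure_not_borel[OF quat_measure] by simp
qed

text \<open>The cosine transform is even in \<open>y\<close> and the sine transform odd, so the
  values at \<open>y\<close> and \<open>- y\<close> on a single imaginary axis separate them;
  \<open>u\<close> is nonzero and cancels.\<close>

lemma eq_0_if_laplace_eq_0:
  assumes u: "norm u = 1" "qRe u = 0" and 0: "\<And>y. laplace \<mu> (y *\<^sub>R u) = 0"
  shows "\<mu> A = 0"
proof -
  have "cos_transform y = 0 \<and> sin_transform y = 0" for y
  proof -
    have 1: "cos_transform y = sin_transform y * u"
      using 0[of y] laplace_imaginary_axis[OF u, of y] by simp
    have 2: "cos_transform y = - (sin_transform y * u)"
      using 0[of "- y"] laplace_imaginary_axis[OF u, of "- y"]
      by (simp add: transform_minus eq_neg_iff_add_eq_0)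
    have "(2::real) *\<^sub>R cos_transform y = cos_transform y + cos_transform y"
      by (rule scaleR_2)
    also have "\<dots> = 0"
      using 1 2 by (metis add.right_inverse)
    finally have "cos_transform y = 0"
      by simp
    moreover have "u \<noteq> 0"
      using u(1) by auto
    ultimately show ?thesis
      using 1 by simp
  qed
  then show ?thesis
    using component_eq_0 by (intro euclidean_eqI[of "\<mu> A"]) (simp add: norm_Basis)
qed

lemma real_if_laplace_intrinsic:
  assumes "\<And>u y. u \<in> {Quat 0 1 0 0, Quat 0 0 1 0, Quat 0 0 0 1} \<Longrightarrow>
    laplace \<mu> (qcnj (y *\<^sub>R u)) = qcnj (laplace \<mu> (y *\<^sub>R u))"
  shows "\<mu> A \<in> \<real>"
proof -
  have 0: "\<mu> A \<bullet> u = 0" if u: "u \<in> {Quat 0 1 0 0, Quat 0 0 1 0, Quat 0 0 0 1}" for u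
  proof -
    have u': "norm u = 1" "qRe u = 0" "qcnj (y *\<^sub>R u) = (- y) *\<^sub>R u" for y
      using u by (auto simp: norm_quat_def inner_quat_def qcnj_def quat_eq_iff)
    have "cos_transform y + sin_transform y * u = qcnj (cos_transform y - sin_transform y * u)" for y
      using assms[OF u, of y]
      unfolding u'(3) laplace_imaginary_axis[OF u'(1,2)] transform_minus by simp
    \<comment> \<open>The imaginary parts of the equation remove those of the cosine transform. Its
      real part removes only the \<open>u\<close>-component of the sine transform, which is why all
      three units are needed.\<close>
    then have "cos_transform y \<bullet> u = 0 \<and> sin_transform y \<bullet> u = 0" for y
      using u by (auto simp: quat_eq_iff qcnj_def quat_mult_sel inner_quat_def)
    then show ?thesis
      by (intro component_eq_0 u') auto
  qed
  have "\<mu> A = of_real (qRe (\<mu> A))"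
    using 0[of "Quat 0 1 0 0"] 0[of "Quat 0 0 1 0"] 0[of "Quat 0 0 0 1"]
    by (simp add: quat_eq_iff of_real_def inner_quat_def)
  then show ?thesis
    by (metis Reals_of_real)
qed

end

section \<open>The functional calculus\<close>

lemma
  assumes \<mu>: "quat_measure \<mu>" "exp_integrable r \<mu>" and r: "r \<ge> 0" "s \<in> strip r"
  shows laplace_cmult: "laplace (\<lambda>A. a * \<mu> A) s = a * laplace \<mu> s"
    and laplace_add: "quat_measure \<nu> \<Longrightarrow> exp_integrable r \<nu> \<Longrightarrow>
      laplace (\<lambda>A. \<mu> A + \<nu> A) s = laplace \<mu> s + laplace \<nu> s"
  using quat_measure_integral_cmult[OF \<mu> r(1) continuous_on_exp_quat norm_exp_quat_le[OF r(2)], of a]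
    quat_measure_integral_add[OF \<mu> r(1) continuous_on_exp_quat norm_exp_quat_le[OF r(2)], of \<nu>]
  by (simp_all add: laplace_def qscaleL_quat_def)

lemma (in finite_quat_measure_pair) laplace_convolution:
  assumes r: "r \<ge> 0" "exp_integrable r \<mu>" "exp_integrable r \<nu>" and s: "s \<in> strip r"
    and real: "\<And>A. A \<in> sets borel \<Longrightarrow> \<nu> A \<in> \<real>"
  shows "laplace (quat_convolution \<mu> \<nu>) s = laplace \<mu> s * laplace \<nu> s"
proof -
  \<comment> \<open>Evaluated at 1, \<open>Z (- t)\<close> gives the Laplace kernel; the doubled
    sign keeps the exponent in the form of the exponential lemmas.\<close>
  define Z :: "real \<Rightarrow> quat \<Rightarrow> quat" where "Z t v = exp (- ((- t) *\<^sub>R s)) * v" for t v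
  have "quat_measure_integral (quat_convolution \<mu> \<nu>) (\<lambda>t. Z (- t) 1)
      = quat_measure_integral \<mu> (\<lambda>t. Z (- t) (quat_measure_integral \<nu> (\<lambda>t. Z (- t) 1)))"
  proof (rule quat_measure_integral_convolution[where M=1 and r=r])
    show "linear (Z t)" for t
      unfolding Z_def by (intro bounded_linear.linear bounded_linear_mult_right)
    show "Z (t + t') v = Z t (Z t' v)" for t t' v
      using exp_quat_add[of "- t" "- t'" s] by (simp add: Z_def mult.assoc)
    show "continuous_on UNIV (\<lambda>t. Z t v)" for v
      unfolding Z_def
      by (intro continuous_on_mult continuous_on_const continuous_on_compose2[OF continuous_on_exp_quat, of UNIV])
        (auto intro: continuous_intros)
    show "norm (Z t v) \<le> 1 * exp (r * \<bar>t\<bar>) * norm v" for t v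
      unfolding Z_def norm_mult using norm_exp_quat_le[OF s, of "- t"] by (intro mult_right_mono) simp_all
  qed (use r real in auto)
  \<comment> \<open>The inner integral has become a constant factor on the right of the kernel, from
    where it can be taken out of the integral.\<close>
  then have "laplace (quat_convolution \<mu> \<nu>) s
      = quat_measure_integral \<mu> (\<lambda>t. exp (- (t *\<^sub>R s)) *\<^sub>r laplace \<nu> s)"
    by (simp add: Z_def laplace_def qscaleR_quat_def)
  also have "\<dots> = laplace \<mu> s * laplace \<nu> s"
    using quat_measure_integral_qscaleR[OF \<mu>.quat_measure r(2,1) continuous_on_exp_quat
        norm_exp_quat_le[OF s]]
    by (simp add: laplace_def qscaleR_quat_def)
  finally show ?thesis .
qed

text \<open>On the narrower of the two strips, which contains the imaginary axis, the difference of
  the measures has vanishing transform. It is written as a sum with \<open>(- 1) * \<nu> A\<close>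
  so that the rules for multiples and sums apply.\<close>

lemma laplace_unique:
  assumes \<omega>: "\<omega> \<ge> 0" and \<mu>: "quat_measure \<mu>" "is_laplace_of \<omega> \<epsilon> f \<mu>"
    and \<nu>: "quat_measure \<nu>" "is_laplace_of \<omega> \<delta> f \<nu>"
  shows "\<mu> = \<nu>"
proof -
  define r where "r = \<omega> + min \<epsilon> \<delta>"
  have r: "r > 0" "r \<le> \<omega> + \<epsilon>" "r \<le> \<omega> + \<delta>"
    using \<omega> \<mu>(2) \<nu>(2) by (auto simp: r_def is_laplace_of_def)
  have exp: "exp_integrable r \<mu>" "exp_integrable r \<nu>"
    using \<mu>(2) \<nu>(2) r exp_integrable_mono by (auto simp: is_laplace_of_def)
  let ?d = "\<lambda>A. \<mu> A + (- 1) * \<nu> A"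
  have d: "quat_measure ?d" "exp_integrable r ?d"
    by (intro quat_measure_add exp_integrable_add quat_measure_cmult exp_integrable_cmult \<mu> \<nu> exp)+
  interpret finite_quat_measure ?d
    by (rule finite_quat_measureI[OF d]) (use r in simp)
  have "laplace ?d (y *\<^sub>R Quat 0 1 0 0) = 0" for y
  proof -
    let ?s = "y *\<^sub>R Quat 0 1 0 0"
    have s: "?s \<in> strip r" "?s \<in> strip (\<omega> + \<epsilon>)" "?s \<in> strip (\<omega> + \<delta>)"
      using r by (auto simp: strip_def)
    have "laplace ?d ?s = laplace \<mu> ?s + (- 1) * laplace \<nu> ?s"
      using r(1) s(1) \<mu>(1) \<nu>(1) exp quat_measure_cmult exp_integrable_cmult
      by (simp only: laplace_add[of \<mu> r] laplace_cmult[of \<nu> r] less_imp_le)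
    moreover have "f ?s = laplace \<mu> ?s" "f ?s = laplace \<nu> ?s"
      using s(2,3) \<mu>(2) \<nu>(2) unfolding is_laplace_of_def by blast+
    ultimately show ?thesis
      by (metis add.right_inverse mult_minus1)
  qed
  then have "?d A = 0" for A
    by (intro eq_0_if_laplace_eq_0[of "Quat 0 1 0 0"]) (simp_all add: norm_quat_def inner_quat_def)
  then show ?thesis
    by (simp add: fun_eq_iff)
qed

text \<open>Removes the definite description: any representing measure, on any admissible strip,
  computes the operator.\<close>

lemma functional_calculus_eq:
  assumes "\<omega> \<ge> 0" and \<mu>: "quat_measure \<mu>" "is_laplace_of \<omega> \<epsilon> f \<mu>"
  shows "functional_calculus \<omega> Z f v = quat_measure_integral \<mu> (\<lambda>t. Z (- t) v)"
proof -
  have "(THE \<mu>. \<mu> \<in> S_measures \<omega> \<and> (\<exists>\<epsilon>. is_laplace_of \<omega> \<epsilon> f \<mu>)) = \<mu>"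
  proof (rule the_equality)
    show "\<mu> \<in> S_measures \<omega> \<and> (\<exists>\<epsilon>. is_laplace_of \<omega> \<epsilon> f \<mu>)"
      using \<mu> by (auto simp: S_measures_def is_laplace_of_def)
    show "\<mu>' = \<mu>" if "\<mu>' \<in> S_measures \<omega> \<and> (\<exists>\<epsilon>. is_laplace_of \<omega> \<epsilon> f \<mu>')" for \<mu>'
      using that laplace_unique[OF assms(1) _ _ \<mu>] by (auto simp: S_measures_def)
  qed
  then show ?thesis
    by (simp add: functional_calculus_def)
qed

lemma V_functionsI:
  assumes "quat_measure \<mu>" "is_laplace_of \<omega> \<epsilon> f \<mu>"
  shows "f \<in> V_functions \<omega>"
  using assms by (auto simp: V_functions_def S_measures_def is_laplace_of_def)

theorem lemma3p25:
  fixes Z :: "real \<Rightarrow> 'v::two_sided_quat_banach \<Rightarrow> 'v"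
    and D :: "'v set" and T :: "'v \<Rightarrow> 'v"
    and M \<omega> \<epsilon> \<delta> :: real
    and \<mu> \<nu> :: "real set \<Rightarrow> quat"
    and f g :: "quat \<Rightarrow> quat"
    and a :: quat
  assumes "strongly_continuous_group Z"
    and "infinitesimal_generator Z D T"
    and "M > 0" and "\<omega> \<ge> 0"
    and "\<And>t. onorm (Z t) \<le> M * exp (\<omega> * \<bar>t\<bar>)"
    and "S_spectrum D T \<subseteq> {s. - \<omega> < qRe s \<and> qRe s < \<omega>}"
    and "\<mu> \<in> S_measures \<omega>" and "is_laplace_of \<omega> \<epsilon> f \<mu>"
    and "\<nu> \<in> S_measures \<omega>" and "is_laplace_of \<omega> \<delta> g \<nu>"
  shows "((\<lambda>s. a * f s) \<in> V_functions \<omega> \<and>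
          functional_calculus \<omega> Z (\<lambda>s. a * f s) = (\<lambda>v. a *\<^sub>l functional_calculus \<omega> Z f v) \<and>
          (\<lambda>s. f s + g s) \<in> V_functions \<omega> \<and>
          functional_calculus \<omega> Z (\<lambda>s. f s + g s) =
            (\<lambda>v. functional_calculus \<omega> Z f v + functional_calculus \<omega> Z g v)) \<and>
         (intrinsic_on (strip (\<omega> + \<delta>)) g \<longrightarrow>
          (\<forall>A\<in>sets borel. \<nu> A \<in> \<real>) \<and>
          (\<lambda>s. f s * g s) \<in> V_functions \<omega> \<and>
          functional_calculus \<omega> Z (\<lambda>s. f s * g s) =
            functional_calculus \<omega> Z f \<circ> functional_calculus \<omega> Z g)"
proof -
  have \<mu>: "quat_measure \<mu>" and \<nu>: "quat_measure \<nu>"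
    using assms(7,9) by (auto simp: S_measures_def)
  note fc = functional_calculus_eq[OF \<open>\<omega> \<ge> 0\<close>]
  have Z: "right_linear (Z t)" "\<exists>K. \<forall>v. norm (Z t v) \<le> K * norm v" "Z (s + t) = Z s \<circ> Z t"
    "continuous_on UNIV (\<lambda>t. Z t v)" for s t v
    using assms(1) by (auto simp: strongly_continuous_group_def bounded_right_linear_operators_def)
  have linear: "linear (Z t)" for t
  proof (rule linearI)
    have Zt: "Z t (u *\<^sub>r b + v) = Z t u *\<^sub>r b + Z t v" for u v b
      using Z(1) by (simp add: right_linear_def)
    have one: "v *\<^sub>r 1 = v" for v :: 'v
      using qscaleR_of_real[of v 1] by simp
    show "Z t (u + v) = Z t u + Z t v" for u v
      using Zt[of u 1 v] by (simp add: one)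
    \<comment> \<open>Right linearity yields homogeneity only with an additive term
      \<open>Z t 0\<close>, which must vanish first.\<close>
    have "Z t 0 = 0"
      using Zt[of 0 1 0] by (simp add: one)
    then show "Z t (c *\<^sub>R v) = c *\<^sub>R Z t v" for c v
      using Zt[of v "of_real c" 0] by (simp add: qscaleR_of_real)
  qed
  have norm_Z: "norm (Z t v) \<le> M * exp (\<omega> * \<bar>t\<bar>) * norm v" for t v
  proof -
    \<comment> \<open>\<open>onorm\<close> controls the operator only once boundedness is known; the
      constant \<open>K\<close> comes from the group axioms.\<close>
    have "bounded_linear (Z t)"
    proof -
      obtain K where "norm (Z t v) \<le> K * norm v" for v
        using Z(2) by blast
      then show ?thesis
        using linear_add[OF linear] linear_scale[OF linear]
        by (intro bounded_linear_intro[of _ K]) (auto simp: mult.commute)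
    qed
    then have "norm (Z t v) \<le> onorm (Z t) * norm v"
      by (rule onorm)
    also have "\<dots> \<le> M * exp (\<omega> * \<bar>t\<bar>) * norm v"
      using assms(5) by (intro mult_right_mono) auto
    finally show ?thesis .
  qed
  \<comment> \<open>The half-width of the common strip: weights with this exponent are integrable
    for both measures, and \<open>\<omega> \<le> r\<close> lets them dominate the growth of the
    group.\<close>
  define r where "r = \<omega> + min \<epsilon> \<delta>"
  have min: "min \<epsilon> \<delta> > 0" and r: "r \<ge> 0" "\<omega> \<le> r" "r \<le> \<omega> + \<epsilon>" "r \<le> \<omega> + \<delta>"
    using \<open>\<omega> \<ge> 0\<close> assms(8,10) by (auto simp: r_def is_laplace_of_def)
  have exp: "exp_integrable (\<omega> + \<epsilon>) \<mu>" "exp_integrable r \<mu>" "exp_integrable r \<nu>"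
    using assms(8,10) r exp_integrable_mono by (auto simp: is_laplace_of_def)
  have laplace: "f s = laplace \<mu> s" "g s = laplace \<nu> s" if "s \<in> strip r" for s
    using that assms(8,10) r by (auto simp: is_laplace_of_def strip_def)
  have cont: "continuous_on UNIV (\<lambda>t. Z (- t) v)" for v
    by (rule continuous_on_compose2[OF Z(4)]) (auto intro: continuous_intros)
  have bound: "norm (Z t v) \<le> M * exp (r * \<bar>t\<bar>) * norm v" for t v
  proof -
    have "M * exp (\<omega> * \<bar>t\<bar>) * norm v \<le> M * exp (r * \<bar>t\<bar>) * norm v"
      using \<open>M > 0\<close> r(2) by (intro mult_right_mono mult_left_mono) (auto intro: mult_right_mono)
    then show ?thesis
      using norm_Z[of t v] by linarith
  qed
  then have bound': "norm (Z (- t) v) \<le> (M * norm v) * exp (r * \<bar>t\<bar>)" for t v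
    using bound[of "- t" v] by (simp add: ac_simps)
  have cmult: "is_laplace_of \<omega> (min \<epsilon> \<delta>) (\<lambda>s. a * f s) (\<lambda>A. a * \<mu> A)"
    using min laplace exp_integrable_cmult[OF \<mu> exp(2)] laplace_cmult[OF \<mu> exp(2) r(1)]
    by (simp add: is_laplace_of_def r_def)
  have add: "is_laplace_of \<omega> (min \<epsilon> \<delta>) (\<lambda>s. f s + g s) (\<lambda>A. \<mu> A + \<nu> A)"
    using min laplace exp_integrable_add[OF \<mu> exp(2) \<nu> exp(3)] laplace_add[OF \<mu> exp(2) r(1) _ \<nu> exp(3)]
    by (simp add: is_laplace_of_def r_def)
  have fc_cmult: "functional_calculus \<omega> Z (\<lambda>s. a * f s) = (\<lambda>v. a *\<^sub>l functional_calculus \<omega> Z f v)"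
    using quat_measure_integral_cmult[OF \<mu> exp(2) r(1) cont bound']
    by (simp add: fc[OF quat_measure_cmult[OF \<mu>] cmult] fc[OF \<mu> assms(8)] fun_eq_iff)
  have fc_add: "functional_calculus \<omega> Z (\<lambda>s. f s + g s) =
      (\<lambda>v. functional_calculus \<omega> Z f v + functional_calculus \<omega> Z g v)"
    using quat_measure_integral_add[OF \<mu> exp(2) r(1) cont bound' \<nu> exp(3)]
    by (simp add: fc[OF quat_measure_add[OF \<mu> \<nu>] add] fc[OF \<mu> assms(8)] fc[OF \<nu> assms(10)] fun_eq_iff)
  have intrinsic: "(\<forall>A\<in>sets borel. \<nu> A \<in> \<real>) \<and> (\<lambda>s. f s * g s) \<in> V_functions \<omega> \<and>
      functional_calculus \<omega> Z (\<lambda>s. f s * g s) = functional_calculus \<omega> Z f \<circ> functional_calculus \<omega> Z g"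
    if "intrinsic_on (strip (\<omega> + \<delta>)) g"
  proof -
    interpret finite_quat_measure_pair \<mu> \<nu>
      by (intro finite_quat_measure_pair.intro finite_quat_measureI[OF \<mu> exp(2) r(1)]
          finite_quat_measureI[OF \<nu> exp(3) r(1)])
    have real: "\<nu> A \<in> \<real>" for A
    proof (rule \<nu>.real_if_laplace_intrinsic)
      fix u y assume "u \<in> {Quat 0 1 0 0, Quat 0 0 1 0, Quat 0 0 0 1}"
      then have u: "qRe u = 0"
        by auto
      \<comment> \<open>Positive even for \<open>\<omega> = 0\<close>, so the imaginary axes lie in
        the strip.\<close>
      have "r > 0"
        unfolding r_def using \<open>\<omega> \<ge> 0\<close> min by (rule add_nonneg_pos)
      then have "y *\<^sub>R u \<in> strip r" "qcnj (y *\<^sub>R u) \<in> strip r" "y *\<^sub>R u \<in> strip (\<omega> + \<delta>)"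
        using u r by (auto simp: strip_def qcnj_def)
      then show "laplace \<nu> (qcnj (y *\<^sub>R u)) = qcnj (laplace \<nu> (y *\<^sub>R u))"
        using that by (metis intrinsic_on_def laplace(2))
    qed
    have mult: "is_laplace_of \<omega> (min \<epsilon> \<delta>) (\<lambda>s. f s * g s) (quat_convolution \<mu> \<nu>)"
      using min laplace exp_integrable_convolution[OF r(1) exp(2,3)]
        laplace_convolution[OF r(1) exp(2,3) _ real]
      by (simp add: is_laplace_of_def r_def)
    have "functional_calculus \<omega> Z (\<lambda>s. f s * g s) = functional_calculus \<omega> Z f \<circ> functional_calculus \<omega> Z g"
    proof
      fix v
      show "functional_calculus \<omega> Z (\<lambda>s. f s * g s) v = (functional_calculus \<omega> Z f \<circ> functional_calculus \<omega> Z g) v"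
        using quat_measure_integral_convolution[OF linear _ Z(4) bound _ r(1) exp(2,3) real, of v] Z(3) \<open>M > 0\<close>
        by (simp add: fc[OF quat_measure_convolution mult] fc[OF \<mu> assms(8)] fc[OF \<nu> assms(10)])
    qed
    then show ?thesis
      using real V_functionsI[OF quat_measure_convolution mult] by blast
  qed
  show ?thesis
    using V_functionsI[OF quat_measure_cmult[OF \<mu>] cmult] V_functionsI[OF quat_measure_add[OF \<mu> \<nu>] add]
      fc_cmult fc_add intrinsic by blast
qed

end
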